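(* There is a universal constant $\kappa>0$ such that the following holds. Let $n\ge 2$ and let $M$ and $N$ be two $n\times n$ complex hermitian matrices. Let $A\sim\rho_M$ and $B\sim\rho_N$ be independent random hermitian matrices, and let $H=A+B$. Then for every $x\in\mathbb{R}$, \[ \operatorname{Var}(F_H(x))\le \kappa\, \frac{\log n}{n}, \] and for every $t\ge 0$, \[ \mathbb{P}\{|F_H(x)-\mathbb{E}(F_H(x))|\ge t\}\le 2\exp\Bigl(-\frac{n t^2}{2\kappa\log n}\Bigr). \] The constant $\kappa$ does not depend on $n$, $M$, $N$, $x$ or $t$.
   Context: For an $n\times n$ hermitian matrix $M$: the empirical spectral measure $\mu_M$ is the probability measure on $\mathbb{R}$ putting mass $1/n$ on each eigenvalue of $M$ (counted with multiplicity); the empirical distribution function $F_M(x)=\mu_M((-\infty,x])$ is its cumulative distribution function. $\rho_M$ denotes the law of $UMU^*$ where $U$ is a random unitary matrix distributed according to the normalized Haar measure on the group $\mathcal{U}_n$ of $n\times n$ unitary matrices (i.e. the "uniform distribution" on hermitian matrices with the same spectrum as $M$). *)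

theory Defs
  imports "Jordan_Normal_Form.Schur_Decomposition" "Jordan_Normal_Form.Char_Poly"
    "HOL-Probability.Probability"
begin

definition hermitian_mat :: "nat \<Rightarrow> complex mat \<Rightarrow> bool" where
  "hermitian_mat n M \<longleftrightarrow> M \<in> carrier_mat n n \<and> mat_adjoint M = M"

definition unitary_set :: "nat \<Rightarrow> complex mat set" where
  "unitary_set n = {U \<in> carrier_mat n n. mat_adjoint U * U = 1\<^sub>m n}"

definition unitary_space :: "nat \<Rightarrow> complex mat measure" where
  "unitary_space n = sigma (unitary_set n)
     {(\<lambda>U. U $$ (i,j)) -` S \<inter> unitary_set n | i j S. i < n \<and> j < n \<and> S \<in> sets borel}"

text \<open>Normalized Haar measure on U_n: a left-invariant probability measure
  (it exists and is unique).\<close>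
definition is_haar :: "nat \<Rightarrow> complex mat measure \<Rightarrow> bool" where
  "is_haar n \<mu> \<longleftrightarrow> prob_space \<mu> \<and> sets \<mu> = sets (unitary_space n) \<and>
     (\<forall>W \<in> unitary_set n. distr \<mu> (unitary_space n) (\<lambda>U. W * U) = \<mu>)"

definition esd_cdf :: "complex mat \<Rightarrow> real \<Rightarrow> real" where
  "esd_cdf M x = real (size (filter_mset (\<lambda>z. Re z \<le> x) (proots (char_poly M)))) / real (dim_row M)"

end

(* The group U_n has the chain of stabilizers of the first j basis vectors, and a complex Householder
   reflection carries an element of one stabilizer into the next. A Haar unitary is therefore built up
   in n independent steps, and resampling one step changes U^* only off a subspace of codimension 2.
   By the min-max argument this moves the empirical distribution function of
   U M U^* + V N V^* by at most 2/n. Hoeffding's lemma, applied to each of the 2n steps, bounds the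
   moment generating function of the centred F_H(x) by exp (s^2/n), so the
   bounds hold even without the factor log n. *)

theory Submission
  imports Defs
begin

unbundle no vec_syntax
hide_type (open) Finite_Cartesian_Product.vec
hide_const (open) Finite_Cartesian_Product.mat Finite_Cartesian_Product.vec Determinants.det

subsection \<open>Adjoints and unitary matrices\<close>

text \<open>Codimension 2 arises because two reflections are involved. If \<open>H\<close> and
  \<open>H'\<close> belong to two elements of one stabilizer, then after correction by an element of
  the smaller stabilizer these differ by the factor \<open>H * mat_adjoint H'\<close>, and each
  reflection fixes a hyperplane. A step thus has oscillation c = 2/n, Hoeffding contributes c^2/8 =
  1/(2 n^2), and the 2n steps sum to 1/n. The obstacle is that the steps live on coset spaces, while
  the only measure at hand is one left-invariant probability measure on the whole group. The
  reflections supply the others: the map \<open>reflect n j\<close> from one stabilizer to the next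
  commutes with left multiplication by the smaller one, so the image of a left-invariant measure is
  left-invariant. Right invariance, which makes the average over a coset independent of its
  representative, follows from left invariance by Fubini.\<close>

lemma mat_adjoint_carrier [simp, intro]:
  "A \<in> carrier_mat n m \<Longrightarrow> mat_adjoint A \<in> carrier_mat m n"
  by (auto simp: mat_adjoint_def)

lemma dim_mat_adjoint [simp]:
  "dim_row (mat_adjoint A) = dim_col A" "dim_col (mat_adjoint A) = dim_row A"
  by (auto simp: mat_adjoint_def)

lemma index_mat_adjoint [simp]:
  fixes A :: "complex mat"
  shows "i < dim_col A \<Longrightarrow> j < dim_row A \<Longrightarrow> mat_adjoint A $$ (i, j) = cnj (A $$ (j, i))"
  by (simp add: mat_adjoint_def mat_of_rows_def)

lemma index_mult_mat_sum:
  assumes "A \<in> carrier_mat n m" "B \<in> carrier_mat m p" "i < n" "j < p"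
  shows "(A * B) $$ (i, j) = (\<Sum>k<m. A $$ (i, k) * B $$ (k, j))"
  using assms by (auto simp: scalar_prod_def lessThan_atLeast0 intro!: sum.cong)

lemma index_mult_mat_vec_sum:
  assumes "A \<in> carrier_mat n m" "v \<in> carrier_vec m" "i < n"
  shows "(A *\<^sub>v v) $ i = (\<Sum>k<m. A $$ (i, k) * v $ k)"
  using assms by (auto simp: scalar_prod_def lessThan_atLeast0 intro!: sum.cong)

lemma cscalar_prod_sum:
  fixes v w :: "complex vec"
  assumes "w \<in> carrier_vec n"
  shows "v \<bullet>c w = (\<Sum>k<n. v $ k * cnj (w $ k))"
  using assms by (auto simp: scalar_prod_def lessThan_atLeast0 intro!: sum.cong)

lemma mat_adjoint_adjoint [simp]:
  fixes A :: "complex mat"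
  shows "mat_adjoint (mat_adjoint A) = A"
  by (rule eq_matI) auto

lemma mat_adjoint_mult:
  fixes A B :: "complex mat"
  assumes "A \<in> carrier_mat n m" "B \<in> carrier_mat m p"
  shows "mat_adjoint (A * B) = mat_adjoint B * mat_adjoint A"
proof (rule eq_matI)
  fix i j assume "i < dim_row (mat_adjoint B * mat_adjoint A)" "j < dim_col (mat_adjoint B * mat_adjoint A)"
  then have ij: "i < p" "j < n" using assms by auto
  have "mat_adjoint (A * B) $$ (i, j) = cnj ((A * B) $$ (j, i))"
    using ij assms by auto
  also have "\<dots> = (\<Sum>k<m. mat_adjoint B $$ (i, k) * mat_adjoint A $$ (k, j))"
    using ij assms by (subst index_mult_mat_sum[OF assms ij(2,1)]) (auto intro!: sum.cong)
  also have "\<dots> = (mat_adjoint B * mat_adjoint A) $$ (i, j)"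
    using ij assms by (subst index_mult_mat_sum[of _ p m _ n]) auto
  finally show "mat_adjoint (A * B) $$ (i, j) = (mat_adjoint B * mat_adjoint A) $$ (i, j)" .
qed (use assms in auto)

lemma mat_adjoint_add:
  fixes A B :: "complex mat"
  assumes "A \<in> carrier_mat n m" "B \<in> carrier_mat n m"
  shows "mat_adjoint (A + B) = mat_adjoint A + mat_adjoint B"
  using assms by (intro eq_matI) auto

lemma mat_adjoint_one [simp]: "mat_adjoint (1\<^sub>m n :: complex mat) = 1\<^sub>m n"
  by (intro eq_matI) auto

lemma cscalar_prod_mult_mat_vec:
  fixes A :: "complex mat"
  assumes "A \<in> carrier_mat n m" "v \<in> carrier_vec m" "w \<in> carrier_vec n"
  shows "(A *\<^sub>v v) \<bullet>c w = v \<bullet>c (mat_adjoint A *\<^sub>v w)"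
proof -
  have "(A *\<^sub>v v) \<bullet>c w = (\<Sum>i<n. \<Sum>k<m. A $$ (i, k) * v $ k * cnj (w $ i))"
    by (subst cscalar_prod_sum[OF assms(3)])
       (auto intro!: sum.cong simp: index_mult_mat_vec_sum[OF assms(1,2)] sum_distrib_right simp del: index_mult_mat_vec)
  also have "\<dots> = (\<Sum>k<m. \<Sum>i<n. A $$ (i, k) * v $ k * cnj (w $ i))"
    by (rule sum.swap)
  also have "\<dots> = (\<Sum>k<m. v $ k * cnj ((mat_adjoint A *\<^sub>v w) $ k))"
  proof (intro sum.cong refl)
    fix k assume "k \<in> {..<m}"
    then have "(mat_adjoint A *\<^sub>v w) $ k = (\<Sum>i<n. mat_adjoint A $$ (k, i) * w $ i)"
      using assms by (subst index_mult_mat_vec_sum[of _ m n]) auto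
    also have "\<dots> = (\<Sum>i<n. cnj (A $$ (i, k)) * w $ i)"
      using assms \<open>k \<in> {..<m}\<close> by (auto intro!: sum.cong)
    finally show "(\<Sum>i<n. A $$ (i, k) * v $ k * cnj (w $ i)) = v $ k * cnj ((mat_adjoint A *\<^sub>v w) $ k)"
      by (simp add: sum_distrib_left mult_ac)
  qed
  also have "\<dots> = v \<bullet>c (mat_adjoint A *\<^sub>v w)"
    by (rule cscalar_prod_sum[OF mult_mat_vec_carrier[OF mat_adjoint_carrier[OF assms(1)] assms(3)], symmetric])
  finally show ?thesis .
qed

text \<open>The dimension count behind the min-max argument. The conjugated vectors, padded with
  zero rows, form a square matrix whose kernel is the orthogonal complement of \<open>B\<close>;
  fewer than \<open>n\<close> vectors leave a zero row, so the matrix is singular.\<close>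

lemma exists_nonzero_orthogonal:
  fixes B :: "complex vec set"
  assumes B: "finite B" "card B < n" "B \<subseteq> carrier_vec n"
  obtains v where "v \<in> carrier_vec n" "v \<noteq> 0\<^sub>v n" "\<And>b. b \<in> B \<Longrightarrow> v \<bullet>c b = 0"
proof -
  obtain bs where bs: "set bs = B" "distinct bs" using finite_distinct_list[OF B(1)] by blast
  then have len: "length bs < n" using B(2) distinct_card by fastforce
  define A :: "complex mat" where
    "A = mat n n (\<lambda>(i, j). if i < length bs then cnj (bs ! i $ j) else 0)"
  have A: "A \<in> carrier_mat n n" by (simp add: A_def)
  \<comment> \<open>Rows are counted from 0, so row \<open>length bs\<close> of \<open>A\<close> is
    the first padding row and this basis vector lies in the kernel of the adjoint.\<close>
  have "mat_adjoint A *\<^sub>v unit_vec n (length bs) = 0\<^sub>v n"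
  proof (rule eq_vecI)
    fix i assume "i < dim_vec (0\<^sub>v n :: complex vec)"
    then show "(mat_adjoint A *\<^sub>v unit_vec n (length bs)) $ i = (0\<^sub>v n :: complex vec) $ i"
      using A len by (subst index_mult_mat_vec_sum[of _ n n]) (auto simp: A_def intro!: sum.neutral)
  qed (use A in auto)
  moreover have "unit_vec n (length bs) \<noteq> (0\<^sub>v n :: complex vec)"
    using len by (metis index_unit_vec(2) index_zero_vec(1) zero_neq_one)
  ultimately have "det (mat_adjoint A) = 0"
    using A det_0_iff_vec_prod_zero[of "mat_adjoint A" n] unit_vec_carrier by blast
  \<comment> \<open>Singularity moves from the adjoint back to \<open>A\<close>: the adjoint of an
    inverse of \<open>A\<close> would be a left inverse of \<open>mat_adjoint A\<close>.\<close>
  have "det A = 0"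
  proof (rule ccontr)
    assume "det A \<noteq> 0"
    then obtain C where C: "C \<in> carrier_mat n n" "A * C = 1\<^sub>m n"
      using A det_non_zero_imp_unit[OF A] unfolding Units_def ring_mat_def by auto
    have "mat_adjoint C * mat_adjoint A = 1\<^sub>m n"
      using C A by (metis mat_adjoint_mult mat_adjoint_one)
    then have "unit_vec n (length bs) = (mat_adjoint C * mat_adjoint A) *\<^sub>v (unit_vec n (length bs) :: complex vec)"
      by simp
    also have "\<dots> = 0\<^sub>v n"
      using A C \<open>mat_adjoint A *\<^sub>v unit_vec n (length bs) = 0\<^sub>v n\<close>
      by (subst assoc_mult_mat_vec[of _ n n _ n]) auto
    finally show False using \<open>unit_vec n (length bs) \<noteq> (0\<^sub>v n :: complex vec)\<close> by simp
  qed
  then obtain v where v: "v \<in> carrier_vec n" "v \<noteq> 0\<^sub>v n" "A *\<^sub>v v = 0\<^sub>v n"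
    using det_0_iff_vec_prod_zero[OF A] by auto
  have "v \<bullet>c b = 0" if b: "b \<in> B" for b
  proof -
    obtain i where i: "i < length bs" "bs ! i = b" using b bs by (metis in_set_conv_nth)
    have "v \<bullet>c b = (A *\<^sub>v v) $ i"
      using i len b B cscalar_prod_sum[of b n v]
      by (subst index_mult_mat_vec_sum[OF A v(1)]) (auto simp: A_def mult.commute intro!: sum.cong)
    then show ?thesis using v i len by simp
  qed
  then show ?thesis using that v by blast
qed

section \<open>The unitary group\<close>

lemma unitary_setD:
  assumes "U \<in> unitary_set n"
  shows "U \<in> carrier_mat n n" "mat_adjoint U * U = 1\<^sub>m n" "U * mat_adjoint U = 1\<^sub>m n"
proof -
  show U: "U \<in> carrier_mat n n" and UU: "mat_adjoint U * U = 1\<^sub>m n"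
    using assms by (simp_all add: unitary_set_def)
  show "U * mat_adjoint U = 1\<^sub>m n"
    by (rule mat_mult_left_right_inverse[OF mat_adjoint_carrier[OF U] U UU])
qed

lemma unitary_set_adjoint [intro]:
  assumes "U \<in> unitary_set n"
  shows "mat_adjoint U \<in> unitary_set n"
  using unitary_setD[OF assms] by (simp add: unitary_set_def)

lemma unitary_set_one [intro]: "1\<^sub>m n \<in> unitary_set n"
  by (simp add: unitary_set_def)

lemma unitary_adjoint_cancel:
  assumes "U \<in> unitary_set n" "A \<in> carrier_mat n m"
  shows "mat_adjoint U * (U * A) = A" "U * (mat_adjoint U * A) = A"
proof -
  note U = unitary_setD[OF assms(1)]
  have "mat_adjoint U * (U * A) = (mat_adjoint U * U) * A"
    using U(1) assms(2) by (intro assoc_mult_mat[symmetric]) auto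
  then show "mat_adjoint U * (U * A) = A" using U(2) assms(2) by simp
  have "U * (mat_adjoint U * A) = (U * mat_adjoint U) * A"
    using U(1) assms(2) by (intro assoc_mult_mat[symmetric]) auto
  then show "U * (mat_adjoint U * A) = A" using U(3) assms(2) by simp
qed

lemma unitary_adjoint_cancel_vec:
  assumes "U \<in> unitary_set n" "v \<in> carrier_vec n"
  shows "mat_adjoint U *\<^sub>v (U *\<^sub>v v) = v" "U *\<^sub>v (mat_adjoint U *\<^sub>v v) = v"
proof -
  note U = unitary_setD[OF assms(1)]
  have "mat_adjoint U *\<^sub>v (U *\<^sub>v v) = (mat_adjoint U * U) *\<^sub>v v"
    using U(1) assms(2) by (intro assoc_mult_mat_vec[symmetric]) auto
  then show "mat_adjoint U *\<^sub>v (U *\<^sub>v v) = v" using U(2) assms(2) by simp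
  have "U *\<^sub>v (mat_adjoint U *\<^sub>v v) = (U * mat_adjoint U) *\<^sub>v v"
    using U(1) assms(2) by (intro assoc_mult_mat_vec[symmetric]) auto
  then show "U *\<^sub>v (mat_adjoint U *\<^sub>v v) = v" using U(3) assms(2) by simp
qed

lemma unitary_set_mult [intro]:
  assumes "U \<in> unitary_set n" "V \<in> unitary_set n"
  shows "U * V \<in> unitary_set n"
proof -
  note U = unitary_setD[OF assms(1)] and V = unitary_setD[OF assms(2)]
  have "mat_adjoint (U * V) * (U * V) = mat_adjoint V * (mat_adjoint U * (U * V))"
    using U(1) V(1) by (simp add: mat_adjoint_mult[of _ n n _ n] assoc_mult_mat[of _ n n _ n _ n])
  also have "\<dots> = 1\<^sub>m n"
    unfolding unitary_adjoint_cancel(1)[OF assms(1) V(1)] by (rule V(2))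
  finally show ?thesis using U(1) V(1) by (simp add: unitary_set_def)
qed

lemma unitary_norm:
  assumes "U \<in> unitary_set n" "v \<in> carrier_vec n"
  shows "(U *\<^sub>v v) \<bullet>c (U *\<^sub>v v) = v \<bullet>c v"
proof -
  note U = unitary_setD[OF assms(1)]
  have "mat_adjoint U *\<^sub>v (U *\<^sub>v v) = v"
    by (rule unitary_adjoint_cancel_vec(1)[OF assms])
  moreover have "U *\<^sub>v v \<in> carrier_vec n"
    using U(1) assms(2) by (rule mult_mat_vec_carrier)
  ultimately show ?thesis
    using cscalar_prod_mult_mat_vec[OF U(1) assms(2), of "U *\<^sub>v v"] by simp
qed

subsection \<open>Householder reflections and the stabilizer chain\<close>

text \<open>For \<open>r = e\<^sub>j\<close> the division by zero makes this the identity, which is the value needed there.\<close>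

definition householder :: "nat \<Rightarrow> nat \<Rightarrow> complex vec \<Rightarrow> complex mat" where
  "householder n j r =
     (let u = unit_vec n j - r
      in mat n n (\<lambda>(i, k). (if i = k then 1 else 0) - 1 / cnj (1 - r $ j) * (u $ i * cnj (u $ k))))"

lemma householder_carrier [simp, intro]: "householder n j r \<in> carrier_mat n n"
  by (simp add: householder_def Let_def)

lemma householder_mult_vec:
  assumes "r \<in> carrier_vec n" "v \<in> carrier_vec n"
  shows "householder n j r *\<^sub>v v =
    v - (1 / cnj (1 - r $ j) * (v \<bullet>c (unit_vec n j - r))) \<cdot>\<^sub>v (unit_vec n j - r)"
proof (rule eq_vecI)
  define u where "u = unit_vec n j - r"
  define a where "a = 1 / cnj (1 - r $ j)"
  have u: "u \<in> carrier_vec n" using assms by (simp add: u_def)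
  fix i assume "i < dim_vec (v - (1 / cnj (1 - r $ j) * (v \<bullet>c (unit_vec n j - r))) \<cdot>\<^sub>v (unit_vec n j - r))"
  then have i: "i < n" using assms by simp
  have "(householder n j r *\<^sub>v v) $ i = (\<Sum>k<n. householder n j r $$ (i, k) * v $ k)"
    by (rule index_mult_mat_vec_sum[of _ n n]) (use i assms in auto)
  also have "\<dots> = (\<Sum>k<n. (if i = k then v $ k else 0) - a * u $ i * (v $ k * cnj (u $ k)))"
    using i by (intro sum.cong)
      (auto simp: householder_def Let_def a_def u_def[symmetric] algebra_simps)
  also have "\<dots> = v $ i - a * u $ i * (v \<bullet>c u)"
    using i by (simp add: sum_subtractf cscalar_prod_sum[OF u] sum_distrib_left)
  finally show "(householder n j r *\<^sub>v v) $ i =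
    (v - (1 / cnj (1 - r $ j) * (v \<bullet>c (unit_vec n j - r))) \<cdot>\<^sub>v (unit_vec n j - r)) $ i"
    using i u assms by (simp add: a_def u_def mult_ac)
qed (use assms in \<open>simp add: householder_def Let_def\<close>)

text \<open>The adjoint only replaces the scalar of the rank-one term by its conjugate, so it fixes
  the same hyperplane as the reflection. One reflection therefore costs one dimension.\<close>

lemma adjoint_householder_mult_vec:
  assumes "r \<in> carrier_vec n" "v \<in> carrier_vec n" "v \<bullet>c (unit_vec n j - r) = 0"
  shows "mat_adjoint (householder n j r) *\<^sub>v v = v"
proof (rule eq_vecI)
  define u where "u = unit_vec n j - r"
  define a where "a = 1 / (1 - r $ j)"
  have u: "u \<in> carrier_vec n" using assms by (simp add: u_def)
  fix i assume "i < dim_vec v"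
  then have i: "i < n" using assms by simp
  have "(mat_adjoint (householder n j r) *\<^sub>v v) $ i = (\<Sum>k<n. mat_adjoint (householder n j r) $$ (i, k) * v $ k)"
    by (rule index_mult_mat_vec_sum[of _ n n]) (use i assms in auto)
  also have "\<dots> = (\<Sum>k<n. (if i = k then v $ k else 0) - a * u $ i * (v $ k * cnj (u $ k)))"
    using i by (intro sum.cong)
      (auto simp: householder_def Let_def a_def u_def[symmetric] algebra_simps)
  also have "\<dots> = v $ i - a * u $ i * (v \<bullet>c u)"
    using i by (simp add: sum_subtractf cscalar_prod_sum[OF u] sum_distrib_left)
  finally show "(mat_adjoint (householder n j r) *\<^sub>v v) $ i = v $ i"
    using assms by (simp add: u_def)
qed (use assms in \<open>simp add: householder_def Let_def\<close>)

lemma cnorm_square: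
  fixes v :: "complex vec"
  assumes "v \<in> carrier_vec n"
  shows "v \<bullet>c v = complex_of_real (\<Sum>k<n. (cmod (v $ k))\<^sup>2)"
  unfolding cscalar_prod_sum[OF assms] by (simp add: complex_norm_square del: of_real_power)

text \<open>A coordinate equal to 1 exhausts the norm of a unit vector. This identifies the
  degenerate case of the reflection, where its scalar is a division by zero.\<close>

lemma unit_norm_pivot:
  fixes r :: "complex vec"
  assumes "r \<in> carrier_vec n" "r \<bullet>c r = 1" "j < n" "r $ j = 1"
  shows "r = unit_vec n j"
proof (rule eq_vecI)
  have "(\<Sum>k<n. (cmod (r $ k))\<^sup>2) = 1"
    using assms(2) unfolding cnorm_square[OF assms(1)] of_real_eq_1_iff by simp
  moreover have "(\<Sum>k<n. (cmod (r $ k))\<^sup>2) = (cmod (r $ j))\<^sup>2 + (\<Sum>k\<in>{..<n} - {j}. (cmod (r $ k))\<^sup>2)"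
    using assms(3) by (intro sum.remove) auto
  ultimately have "(\<Sum>k\<in>{..<n} - {j}. (cmod (r $ k))\<^sup>2) = 0" using assms(4) by simp
  then have "\<forall>k\<in>{..<n} - {j}. r $ k = 0"
    by (subst (asm) sum_nonneg_eq_0_iff) auto
  then show "r $ i = unit_vec n j $ i" if "i < dim_vec (unit_vec n j)" for i
    using that assms by auto
qed (use assms in simp)

text \<open>With u = e_j - r, the product of e_j with u is \<open>cnj (1 - r $ j)\<close>, which the
  scalar of the reflection cancels, leaving e_j - u. Since \<open>r $ j\<close> need not be real,
  the familiar scalar 2 / |u|^2 would in general not send e_j to r.\<close>

lemma householder_unit_vec:
  assumes "r \<in> carrier_vec n" "r \<bullet>c r = 1" "j < n"
  shows "householder n j r *\<^sub>v unit_vec n j = r"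
proof (cases "r $ j = 1")
  case True
  then have r: "r = unit_vec n j" using unit_norm_pivot assms by blast
  show ?thesis
    unfolding householder_mult_vec[OF assms(1) unit_vec_carrier] by (subst r, rule eq_vecI) (use r in auto)
next
  case False
  have "unit_vec n j \<bullet>c (unit_vec n j - r) = cnj (1 - r $ j)"
    using assms by (subst cscalar_prod_sum[of _ n]) (auto simp: if_distrib[of "\<lambda>x. x * _"] cong: if_cong)
  then have "1 / cnj (1 - r $ j) * (unit_vec n j \<bullet>c (unit_vec n j - r)) = 1"
    using False by simp
  then show ?thesis
    using assms by (subst householder_mult_vec) (auto intro!: eq_vecI)
qed

lemma householder_fixes_unit_vec:
  assumes "r \<in> carrier_vec n" "k < n" "k \<noteq> j" "r $ k = 0"
  shows "householder n j r *\<^sub>v unit_vec n k = unit_vec n k"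
proof -
  have "unit_vec n k \<bullet>c (unit_vec n j - r) = 0"
    using assms by (subst cscalar_prod_sum[of _ n])
      (auto simp: unit_vec_def if_distrib[of "\<lambda>x. x * _"] cong: if_cong)
  then show ?thesis
    using assms by (subst householder_mult_vec) auto
qed

text \<open>The adjoint times the reflection is the identity minus
  \<open>a + cnj a - a * cnj a * s\<close> times the rank-one matrix of \<open>u\<close>. For a unit
  vector \<open>r\<close> the squared norm \<open>s\<close> of \<open>u\<close> is
  \<open>1 - r $ j\<close> plus its conjugate, which is exactly what makes this scalar
  vanish.\<close>

lemma householder_unitary:
  assumes r: "r \<in> carrier_vec n" "r \<bullet>c r = 1" and j: "j < n"
  shows "householder n j r \<in> unitary_set n"
proof -
  define u where "u = unit_vec n j - r"
  define a where "a = 1 / cnj (1 - r $ j)"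
  define H where "H = householder n j r"
  have H: "H \<in> carrier_mat n n" by (simp add: H_def)
  have u: "u \<in> carrier_vec n" using r by (simp add: u_def)
  have Hi: "H $$ (i, k) = (if i = k then 1 else 0) - a * (u $ i * cnj (u $ k))" if "i < n" "k < n" for i k
    using that by (simp add: H_def householder_def Let_def a_def u_def)
  define s where "s = (\<Sum>k<n. u $ k * cnj (u $ k))"
  have uu: "s = (1 - r $ j) + cnj (1 - r $ j)"
  proof -
    have rr: "(\<Sum>k<n. r $ k * cnj (r $ k)) = 1" using r by (simp add: cscalar_prod_sum)
    have "(\<Sum>k<n. u $ k * cnj (u $ k)) =
      (\<Sum>k<n. r $ k * cnj (r $ k) + (if k = j then 1 - r $ k - cnj (r $ k) else 0))"
      using r(1) j by (intro sum.cong) (auto simp: u_def algebra_simps)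
    then show ?thesis using j by (simp add: s_def sum.distrib rr)
  qed
  \<comment> \<open>The rank-one factor is kept in the equation so that it also covers
    \<open>r $ j = 1\<close>, where \<open>u\<close> itself vanishes.\<close>
  have key: "(a + cnj a - a * cnj a * s) * (u $ i * cnj (u $ l)) = 0"
    if "i < n" "l < n" for i l
  proof (cases "r $ j = 1")
    case True
    then have "r = unit_vec n j" using unit_norm_pivot r j by blast
    then have "u $ i = 0" using that by (simp add: u_def)
    then show ?thesis by simp
  next
    case False
    then have "cnj (r $ j) \<noteq> 1" using complex_cnj_cancel_iff[of "r $ j" 1] by simp
    then have "a + cnj a - a * cnj a * s = 0"
      using False unfolding uu a_def by (simp add: field_simps)
    then show ?thesis by simp
  qed
  have "mat_adjoint H * H = 1\<^sub>m n"
  proof (rule eq_matI)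
    fix i l assume "i < dim_row (1\<^sub>m n :: complex mat)" "l < dim_col (1\<^sub>m n :: complex mat)"
    then have il: "i < n" "l < n" by auto
    have "(mat_adjoint H * H) $$ (i, l) = (\<Sum>k<n. cnj (H $$ (k, i)) * H $$ (k, l))"
      using il H by (subst index_mult_mat_sum[of _ n n _ n]) auto
    also have "\<dots> = (\<Sum>k<n. (if k = i then if i = l then 1 else 0 else 0) - (if k = l then cnj a * (u $ i * cnj (u $ l)) else 0)
       - (if k = i then a * (u $ i * cnj (u $ l)) else 0) + a * cnj a * (u $ i * cnj (u $ l)) * (u $ k * cnj (u $ k)))"
      using il by (intro sum.cong) (auto simp: Hi algebra_simps)
    also have "\<dots> = (if i = l then 1 else 0) -
       (a + cnj a - a * cnj a * s) * (u $ i * cnj (u $ l))"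
      using il by (simp add: sum.distrib sum_subtractf flip: sum_distrib_left s_def)
         (simp add: algebra_simps)
    also have "\<dots> = 1\<^sub>m n $$ (i, l)" using key[OF il] il by simp
    finally show "(mat_adjoint H * H) $$ (i, l) = 1\<^sub>m n $$ (i, l)" .
  qed (use H in auto)
  then show ?thesis using H by (simp add: unitary_set_def H_def)
qed

section \<open>The stabilizer chain\<close>

definition stab :: "nat \<Rightarrow> nat \<Rightarrow> complex mat set" where
  "stab n j = {U \<in> unitary_set n. \<forall>k<j. U *\<^sub>v unit_vec n k = unit_vec n k}"

lemma stab_0 [simp]: "stab n 0 = unitary_set n"
  by (simp add: stab_def)

lemma stab_unitary: "U \<in> stab n j \<Longrightarrow> U \<in> unitary_set n"
  by (simp add: stab_def)

lemma stab_mono: "U \<in> stab n (Suc j) \<Longrightarrow> U \<in> stab n j"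
  by (simp add: stab_def)

lemma stab_full: "stab n n \<subseteq> {1\<^sub>m n}"
proof
  fix U assume U: "U \<in> stab n n"
  then have c: "U \<in> carrier_mat n n" using stab_unitary unitary_setD by blast
  have "U $$ (i, k) = 1\<^sub>m n $$ (i, k)" if "i < n" "k < n" for i k
  proof -
    have "U $$ (i, k) = (U *\<^sub>v unit_vec n k) $ i"
      using that c by (subst index_mult_mat_vec_sum[of _ n n]) (auto simp: if_distrib cong: if_cong)
    also have "\<dots> = unit_vec n k $ i" using U that by (simp add: stab_def)
    finally show ?thesis using that by simp
  qed
  then show "U \<in> {1\<^sub>m n}" using c by auto
qed

lemma stab_mult:
  assumes "U \<in> stab n j" "V \<in> stab n j"
  shows "U * V \<in> stab n j"
proof -
  have UV: "U \<in> unitary_set n" "V \<in> unitary_set n" using assms stab_unitary by blast+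
  have "(U * V) *\<^sub>v unit_vec n k = unit_vec n k" if "k < j" for k
    using assms that by (simp add: stab_def assoc_mult_mat_vec[OF unitary_setD(1)[OF UV(1)] unitary_setD(1)[OF UV(2)]])
  then show ?thesis unfolding stab_def using unitary_set_mult[OF UV] by simp
qed

lemma stab_adjoint:
  assumes "U \<in> stab n j"
  shows "mat_adjoint U \<in> stab n j"
proof -
  have U: "U \<in> unitary_set n" using assms stab_unitary by blast
  note u = unitary_setD[OF U]
  have "mat_adjoint U *\<^sub>v unit_vec n k = unit_vec n k" if "k < j" for k
  proof -
    have "mat_adjoint U *\<^sub>v unit_vec n k = mat_adjoint U *\<^sub>v (U *\<^sub>v unit_vec n k)"
      using assms that by (simp add: stab_def)
    also have "\<dots> = unit_vec n k"
      by (rule unitary_adjoint_cancel_vec(1)[OF U unit_vec_carrier])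
    finally show ?thesis .
  qed
  then show ?thesis unfolding stab_def using unitary_set_adjoint[OF U] by simp
qed

text \<open>The Householder factor sends e_j to \<open>mat_adjoint U *\<^sub>v unit_vec n j\<close>,
  which \<open>U\<close> sends back to e_j. It stands on the right so that the map commutes with
  left multiplication by the smaller stabilizer.\<close>

definition reflect :: "nat \<Rightarrow> nat \<Rightarrow> complex mat \<Rightarrow> complex mat" where
  "reflect n j U = U * householder n j (mat_adjoint U *\<^sub>v unit_vec n j)"

lemma adjoint_unit_vec:
  assumes "U \<in> unitary_set n" "j < n"
  shows "mat_adjoint U *\<^sub>v unit_vec n j \<in> carrier_vec n"
    "(mat_adjoint U *\<^sub>v unit_vec n j) \<bullet>c (mat_adjoint U *\<^sub>v unit_vec n j) = 1"
proof -
  show "mat_adjoint U *\<^sub>v unit_vec n j \<in> carrier_vec n"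
    using unitary_setD(1)[OF assms(1)] by (intro mult_mat_vec_carrier[of _ n n]) auto
  have "unit_vec n j \<bullet>c unit_vec n j = (1 :: complex)"
    using assms(2) by (simp add: cscalar_prod_sum[of _ n] if_distrib[of "\<lambda>x. x * _"] cong: if_cong)
  then show "(mat_adjoint U *\<^sub>v unit_vec n j) \<bullet>c (mat_adjoint U *\<^sub>v unit_vec n j) = 1"
    by (subst unitary_norm[OF unitary_set_adjoint[OF assms(1)] unit_vec_carrier])
qed

lemma reflect_unitary:
  assumes "U \<in> unitary_set n" "j < n"
  shows "reflect n j U \<in> unitary_set n"
  unfolding reflect_def
  by (intro unitary_set_mult householder_unitary adjoint_unit_vec assms)

lemma reflect_stab:
  assumes U: "U \<in> stab n j" and j: "j < n"
  shows "reflect n j U \<in> stab n (Suc j)"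
proof -
  define r where "r = mat_adjoint U *\<^sub>v unit_vec n j"
  have uu: "U \<in> unitary_set n" using U stab_unitary by blast
  note u = unitary_setD[OF uu]
  note r = adjoint_unit_vec[OF uu j, folded r_def]
  have "reflect n j U *\<^sub>v unit_vec n k = unit_vec n k" if "k < Suc j" for k
  proof -
    have *: "reflect n j U *\<^sub>v unit_vec n k = U *\<^sub>v (householder n j r *\<^sub>v unit_vec n k)"
      unfolding reflect_def r_def[symmetric]
      by (rule assoc_mult_mat_vec[OF u(1) householder_carrier unit_vec_carrier])
    show ?thesis
    proof (cases "k = j")
      case True
      then have "reflect n j U *\<^sub>v unit_vec n k = U *\<^sub>v r"
        using * householder_unit_vec[OF r j] by simp
      also have "\<dots> = unit_vec n j"
        unfolding r_def by (rule unitary_adjoint_cancel_vec(2)[OF uu unit_vec_carrier])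
      finally show ?thesis using True by simp
    next
      case False
      then have k: "k < j" "k < n" using that j by auto
      \<comment> \<open>Column \<open>k\<close> of \<open>U\<close> is e_k, so its entry in row
        \<open>j\<close> is zero. Hence \<open>r\<close> has no component along the earlier basis
        vectors, and the reflection leaves them alone.\<close>
      have "r $ k = cnj (U $$ (j, k))"
        unfolding r_def using u k j
        by (subst index_mult_mat_vec_sum[of _ n n]) (auto simp: if_distrib cong: if_cong)
      also have "U $$ (j, k) = (U *\<^sub>v unit_vec n k) $ j"
        using u k j by (subst index_mult_mat_vec_sum[of _ n n]) (auto simp: if_distrib cong: if_cong)
      also have "\<dots> = 0" using U k j by (simp add: stab_def)
      finally have "householder n j r *\<^sub>v unit_vec n k = unit_vec n k"
        using r k False by (intro householder_fixes_unit_vec) auto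
      then show ?thesis using * U k by (simp add: stab_def)
    qed
  qed
  then show ?thesis using reflect_unitary[OF uu j] by (simp add: stab_def)
qed

text \<open>The reflection depends on \<open>U\<close> only through
  \<open>mat_adjoint U *\<^sub>v unit_vec n j\<close>, and \<open>W\<close> fixes e_j. This
  equivariance carries left invariance from one stabilizer to the next.\<close>

lemma reflect_mult:
  assumes W: "W \<in> stab n (Suc j)" and U: "U \<in> unitary_set n"
  shows "reflect n j (W * U) = W * reflect n j U"
proof -
  have w: "W \<in> carrier_mat n n" and u: "U \<in> carrier_mat n n"
    using W U stab_unitary unitary_setD(1) by blast+
  have "mat_adjoint W *\<^sub>v unit_vec n j = unit_vec n j"
    using stab_adjoint[OF W] by (simp add: stab_def)
  then have "mat_adjoint (W * U) *\<^sub>v unit_vec n j = mat_adjoint U *\<^sub>v unit_vec n j"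
    using w u unfolding mat_adjoint_mult[OF w u]
    by (simp add: assoc_mult_mat_vec[of _ n n _ n])
  then show ?thesis
    unfolding reflect_def using w u by (simp add: assoc_mult_mat[of _ n n _ n _ n])
qed

text \<open>The adjoints are compared, since the quadratic form of \<open>U M U\<^sup>*\<close> at \<open>v\<close> depends on
  \<open>U\<^sup>* v\<close> only.\<close>

definition nearby :: "nat \<Rightarrow> complex mat \<Rightarrow> complex mat \<Rightarrow> bool" where
  "nearby n U U' \<longleftrightarrow> (\<exists>a\<in>carrier_vec n. \<exists>b\<in>carrier_vec n. \<forall>v\<in>carrier_vec n.
     v \<bullet>c a = 0 \<longrightarrow> v \<bullet>c b = 0 \<longrightarrow> mat_adjoint U *\<^sub>v v = mat_adjoint U' *\<^sub>v v)"

lemma nearbyI: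
  assumes "a \<in> carrier_vec n" "b \<in> carrier_vec n"
    "\<And>v. v \<in> carrier_vec n \<Longrightarrow> v \<bullet>c a = 0 \<Longrightarrow> v \<bullet>c b = 0 \<Longrightarrow> mat_adjoint U *\<^sub>v v = mat_adjoint U' *\<^sub>v v"
  shows "nearby n U U'"
  using assms unfolding nearby_def by blast

lemma nearbyE:
  assumes "nearby n U U'"
  obtains a b where "a \<in> carrier_vec n" "b \<in> carrier_vec n"
    "\<And>v. v \<in> carrier_vec n \<Longrightarrow> v \<bullet>c a = 0 \<Longrightarrow> v \<bullet>c b = 0 \<Longrightarrow> mat_adjoint U *\<^sub>v v = mat_adjoint U' *\<^sub>v v"
  using assms unfolding nearby_def by blast

lemma adjoint_mult_vec:
  fixes A B :: "complex mat"
  assumes "A \<in> carrier_mat n n" "B \<in> carrier_mat n n" "v \<in> carrier_vec n"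
  shows "mat_adjoint (A * B) *\<^sub>v v = mat_adjoint B *\<^sub>v (mat_adjoint A *\<^sub>v v)"
  unfolding mat_adjoint_mult[OF assms(1,2)]
  by (rule assoc_mult_mat_vec[OF mat_adjoint_carrier[OF assms(2)] mat_adjoint_carrier[OF assms(1)] assms(3)])

lemma nearby_mult_right:
  assumes "nearby n U U'" "U \<in> carrier_mat n n" "U' \<in> carrier_mat n n" "V \<in> carrier_mat n n"
  shows "nearby n (U * V) (U' * V)"
proof -
  obtain a b where ab: "a \<in> carrier_vec n" "b \<in> carrier_vec n"
    "\<And>v. v \<in> carrier_vec n \<Longrightarrow> v \<bullet>c a = 0 \<Longrightarrow> v \<bullet>c b = 0 \<Longrightarrow> mat_adjoint U *\<^sub>v v = mat_adjoint U' *\<^sub>v v"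
    using nearbyE[OF assms(1)] by blast
  show ?thesis
  proof (rule nearbyI[OF ab(1,2)])
    fix v :: "complex vec" assume v: "v \<in> carrier_vec n" "v \<bullet>c a = 0" "v \<bullet>c b = 0"
    show "mat_adjoint (U * V) *\<^sub>v v = mat_adjoint (U' * V) *\<^sub>v v"
      unfolding adjoint_mult_vec[OF assms(2,4) v(1)] adjoint_mult_vec[OF assms(3,4) v(1)] ab(3)[OF v] ..
  qed
qed

text \<open>A vector is orthogonal to \<open>V *\<^sub>v a\<close> when its image under
  \<open>mat_adjoint V\<close> is orthogonal to \<open>a\<close>. So the two exceptional vectors are
  transported by \<open>V\<close>, whereas right multiplication keeps them.\<close>

lemma nearby_mult_left:
  assumes "nearby n U U'" "U \<in> carrier_mat n n" "U' \<in> carrier_mat n n" "V \<in> carrier_mat n n"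
  shows "nearby n (V * U) (V * U')"
proof -
  obtain a b where ab: "a \<in> carrier_vec n" "b \<in> carrier_vec n"
    "\<And>v. v \<in> carrier_vec n \<Longrightarrow> v \<bullet>c a = 0 \<Longrightarrow> v \<bullet>c b = 0 \<Longrightarrow> mat_adjoint U *\<^sub>v v = mat_adjoint U' *\<^sub>v v"
    using nearbyE[OF assms(1)] by blast
  have c: "v \<bullet>c (V *\<^sub>v x) = (mat_adjoint V *\<^sub>v v) \<bullet>c x" if "v \<in> carrier_vec n" "x \<in> carrier_vec n" for v x
    using cscalar_prod_mult_mat_vec[OF mat_adjoint_carrier[OF assms(4)] that] by simp
  show ?thesis
  proof (rule nearbyI)
    fix v :: "complex vec" assume v: "v \<in> carrier_vec n" "v \<bullet>c (V *\<^sub>v a) = 0" "v \<bullet>c (V *\<^sub>v b) = 0"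
    have w: "mat_adjoint V *\<^sub>v v \<in> carrier_vec n"
      using mult_mat_vec_carrier[OF mat_adjoint_carrier[OF assms(4)] v(1)] .
    show "mat_adjoint (V * U) *\<^sub>v v = mat_adjoint (V * U') *\<^sub>v v"
      unfolding adjoint_mult_vec[OF assms(4,2) v(1)] adjoint_mult_vec[OF assms(4,3) v(1)]
      using ab(3)[OF w] v c[OF v(1) ab(1)] c[OF v(1) ab(2)] by simp
  qed (rule mult_mat_vec_carrier[OF assms(4)], fact)+
qed

text \<open>Every coset of the smaller stabilizer contains a point close to a given
  \<open>U\<close>. With \<open>W\<close> the product of \<open>reflect n j U\<close> and the
  adjoint of \<open>reflect n j U'\<close>, the point \<open>W * U'\<close> equals
  \<open>U * (H * mat_adjoint H')\<close>. The adjoint of the last factor fixes every vector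
  orthogonal to both \<open>unit_vec n j - r\<close> and \<open>unit_vec n j - r'\<close>.\<close>

lemma stab_coset_nearby:
  assumes U: "U \<in> stab n j" and U': "U' \<in> stab n j" and j: "j < n"
  obtains W where "W \<in> stab n (Suc j)" "nearby n U (W * U')"
proof
  define r where "r = mat_adjoint U *\<^sub>v unit_vec n j"
  define r' where "r' = mat_adjoint U' *\<^sub>v unit_vec n j"
  define H where "H = householder n j r"
  define H' where "H' = householder n j r'"
  let ?W = "reflect n j U * mat_adjoint (reflect n j U')"
  show "?W \<in> stab n (Suc j)"
    by (intro stab_mult stab_adjoint reflect_stab assms)
  have uu: "U \<in> unitary_set n" "U' \<in> unitary_set n" using U U' stab_unitary by blast+
  have r: "r \<in> carrier_vec n" "r' \<in> carrier_vec n"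
    unfolding r_def r'_def by (rule adjoint_unit_vec(1)[OF _ j], fact)+
  have c: "U \<in> carrier_mat n n" "U' \<in> carrier_mat n n" using uu unitary_setD(1) by blast+
  have h: "H \<in> carrier_mat n n" "H' \<in> carrier_mat n n" by (auto simp: H_def H'_def)
  have R: "reflect n j U = U * H" "reflect n j U' = U' * H'"
    by (simp_all add: reflect_def H_def H'_def r_def r'_def)
  have "mat_adjoint (reflect n j U') * U' = mat_adjoint H' * (mat_adjoint U' * U')"
    unfolding R mat_adjoint_mult[OF c(2) h(2)] using c h by (intro assoc_mult_mat) auto
  then have "mat_adjoint (reflect n j U') * U' = mat_adjoint H'"
    using h unitary_setD(2)[OF uu(2)] by simp
  moreover have "?W * U' = reflect n j U * (mat_adjoint (reflect n j U') * U')"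
    using c h unfolding R by (intro assoc_mult_mat[of _ n n _ n _ n]) auto
  moreover have "(U * H) * mat_adjoint H' = U * (H * mat_adjoint H')"
    using c h by (intro assoc_mult_mat[of _ n n _ n _ n]) auto
  ultimately have W: "?W * U' = U * (H * mat_adjoint H')" by (simp add: R)
  have "nearby n (1\<^sub>m n) (H * mat_adjoint H')"
  proof (rule nearbyI)
    fix v assume v: "v \<in> carrier_vec n" "v \<bullet>c (unit_vec n j - r) = 0" "v \<bullet>c (unit_vec n j - r') = 0"
    have "mat_adjoint (H * mat_adjoint H') *\<^sub>v v = H' *\<^sub>v (mat_adjoint H *\<^sub>v v)"
      using adjoint_mult_vec[OF h(1) mat_adjoint_carrier[OF h(2)] v(1)] by simp
    also have "mat_adjoint H *\<^sub>v v = v"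
      unfolding H_def by (rule adjoint_householder_mult_vec[OF r(1) v(1,2)])
    also have "H' *\<^sub>v v = v"
      unfolding H'_def householder_mult_vec[OF r(2) v(1)] v(3) using v(1) r(2) by auto
    finally show "mat_adjoint (1\<^sub>m n) *\<^sub>v v = mat_adjoint (H * mat_adjoint H') *\<^sub>v v"
      using v by simp
  qed (use r in auto)
  then have "nearby n (U * 1\<^sub>m n) (U * (H * mat_adjoint H'))"
    by (rule nearby_mult_left) (use c h in auto)
  then show "nearby n U (?W * U')" unfolding W using c by simp
qed

subsection \<open>Spectral distribution of hermitian matrices\<close>

definition real_diag_mat :: "nat \<Rightarrow> (nat \<Rightarrow> real) \<Rightarrow> complex mat" where
  "real_diag_mat n d = mat n n (\<lambda>(i, k). if i = k then complex_of_real (d i) else 0)"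

lemma real_diag_mat_carrier [simp, intro]: "real_diag_mat n d \<in> carrier_mat n n"
  by (simp add: real_diag_mat_def)

lemma mult3_mat_vec:
  assumes "X \<in> carrier_mat n n" "Y \<in> carrier_mat n n" "Z \<in> carrier_mat n n" "v \<in> carrier_vec n"
  shows "(X * Y * Z) *\<^sub>v v = X *\<^sub>v (Y *\<^sub>v (Z *\<^sub>v v))"
  using assoc_mult_mat_vec[OF mult_carrier_mat[OF assms(1,2)] assms(3,4)]
    assoc_mult_mat_vec[OF assms(1,2) mult_mat_vec_carrier[OF assms(3,4)]] by simp

lemma conjugate_hermitian:
  assumes "hermitian_mat n A" "U \<in> carrier_mat n n"
  shows "hermitian_mat n (mat_adjoint U * A * U)" "hermitian_mat n (U * A * mat_adjoint U)"
  using assms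
  by (auto simp: hermitian_mat_def mat_adjoint_mult[of _ n n _ n] assoc_mult_mat[of _ n n _ n _ n] mult_carrier_mat[of _ n n _ n])

text \<open>Hermitian symmetry turns the eigenvector condition on the first \<open>j\<close> columns
  into zeros in the first \<open>j\<close> rows from column \<open>j\<close> on. So an eigenvector
  of the lower block, padded with zeros, is one of \<open>A\<close>. The leading zeros let the next
  reflection keep the earlier basis vectors.\<close>

lemma hermitian_block_eigenvector:
  assumes A: "hermitian_mat n A" and j: "j < n"
    and eig: "\<forall>k<j. \<exists>c. A *\<^sub>v unit_vec n k = c \<cdot>\<^sub>v unit_vec n k"
  obtains r e where "r \<in> carrier_vec n" "r \<bullet>c r = 1" "\<And>k. k < j \<Longrightarrow> r $ k = 0" "A *\<^sub>v r = e \<cdot>\<^sub>v r"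
proof -
  have Ac: "A \<in> carrier_mat n n" and Ah: "mat_adjoint A = A" using A by (auto simp: hermitian_mat_def)
  have zero: "A $$ (i, k) = 0" if ik: "i < j" "j \<le> k" "k < n" for i k
  proof -
    obtain c where c: "A *\<^sub>v unit_vec n i = c \<cdot>\<^sub>v unit_vec n i" using eig ik(1) by blast
    have "A $$ (i, k) = cnj (A $$ (k, i))"
      using Ac ik by (subst Ah[symmetric]) simp
    also have "A $$ (k, i) = (A *\<^sub>v unit_vec n i) $ k"
      using ik Ac by (subst index_mult_mat_vec_sum[of _ n n]) (auto simp: if_distrib cong: if_cong)
    also have "\<dots> = 0" unfolding c using ik by simp
    finally show ?thesis by simp
  qed
  define B where "B = mat (n - j) (n - j) (\<lambda>(i, k). A $$ (i + j, k + j))"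
  have B: "B \<in> carrier_mat (n - j) (n - j)" by (simp add: B_def)
  obtain es where es: "char_poly B = (\<Prod>a\<leftarrow>es. [:- a, 1:])" "length es = n - j"
    using char_poly_factorized[OF B] by blast
  then obtain e es' where "es = e # es'" using j by (cases es) auto
  then have "poly (char_poly B) e = 0" using es by simp
  then have "eigenvalue B e" using eigenvalue_root_char_poly[OF B] by simp
  then obtain w where w: "w \<in> carrier_vec (n - j)" "w \<noteq> 0\<^sub>v (n - j)" "B *\<^sub>v w = e \<cdot>\<^sub>v w"
    using B unfolding eigenvalue_def eigenvector_def by auto
  define q where "q = vec n (\<lambda>i. if i < j then 0 else w $ (i - j))"
  have q: "q \<in> carrier_vec n" by (simp add: q_def)
  have qe: "A *\<^sub>v q = e \<cdot>\<^sub>v q"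
  proof (rule eq_vecI)
    fix i assume "i < dim_vec (e \<cdot>\<^sub>v q)"
    then have i: "i < n" using q by simp
    have s: "(A *\<^sub>v q) $ i = (\<Sum>k<n. A $$ (i, k) * q $ k)"
      by (rule index_mult_mat_vec_sum[OF Ac q i])
    show "(A *\<^sub>v q) $ i = (e \<cdot>\<^sub>v q) $ i"
    proof (cases "i < j")
      case True
      then have "(\<Sum>k<n. A $$ (i, k) * q $ k) = 0"
        using zero by (intro sum.neutral) (auto simp: q_def)
      then show ?thesis using s True i by (simp add: q_def)
    next
      case False
      have "(\<Sum>k<n. A $$ (i, k) * q $ k) = (\<Sum>k\<in>{j..<n}. A $$ (i, k) * q $ k)"
        by (rule sum.mono_neutral_right) (auto simp: q_def)
      also have "\<dots> = (\<Sum>k<n-j. B $$ (i - j, k) * w $ k)"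
        using False i by (intro sum.reindex_bij_witness[of _ "\<lambda>k. k + j" "\<lambda>k. k - j"]) (auto simp: B_def q_def)
      also have "\<dots> = (B *\<^sub>v w) $ (i - j)"
        using False i by (subst index_mult_mat_vec_sum[OF B w(1)]) auto
      also have "\<dots> = e * w $ (i - j)" unfolding w(3) using False i w(1) by simp
      finally show ?thesis using s False i by (simp add: q_def)
    qed
  qed (use Ac q in auto)
  obtain i where i: "i < n - j" "w $ i \<noteq> 0" using w(1,2) by (metis carrier_vecD eq_vecI index_zero_vec)
  then have "q $ (i + j) \<noteq> 0" "i + j < n" by (auto simp: q_def)
  define s where "s = (\<Sum>k<n. (cmod (q $ k))\<^sup>2)"
  have s: "s > 0"
    unfolding s_def using \<open>q $ (i + j) \<noteq> 0\<close> \<open>i + j < n\<close>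
    by (intro sum_pos2[of _ "i + j"]) auto
  define t where "t = complex_of_real (1 / sqrt s)"
  define r where "r = t \<cdot>\<^sub>v q"
  have t2: "t * cnj t = complex_of_real (1 / s)"
    using s unfolding t_def complex_cnj_complex_of_real of_real_mult[symmetric] by simp
  have r: "r \<in> carrier_vec n" using q by (simp add: r_def)
  have "r \<bullet>c r = (\<Sum>k<n. t * cnj t * (q $ k * cnj (q $ k)))"
    unfolding cscalar_prod_sum[OF r] using q by (intro sum.cong) (auto simp: r_def)
  also have "\<dots> = t * cnj t * (q \<bullet>c q)"
    by (simp add: cscalar_prod_sum[OF q] sum_distrib_left)
  also have "\<dots> = 1"
    unfolding t2 cnorm_square[OF q] s_def[symmetric] of_real_mult[symmetric] using s by simp
  finally have "r \<bullet>c r = 1" .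
  moreover have "r $ k = 0" if "k < j" for k using that j by (simp add: r_def q_def)
  moreover have "A *\<^sub>v r = e \<cdot>\<^sub>v r"
    using Ac q qe by (simp add: r_def mult_mat_vec[of _ n n] smult_smult_assoc mult.commute)
  ultimately show ?thesis using that r by blast
qed

text \<open>The reflections of the stabilizer chain also diagonalize: each one moves an eigenvector of the
  remaining block to the next basis vector.\<close>

lemma hermitian_diagonalization:
  assumes A: "hermitian_mat n A"
  obtains U d where "U \<in> unitary_set n" "mat_adjoint U * A * U = real_diag_mat n d"
proof -
  have Ac: "A \<in> carrier_mat n n" using A by (simp add: hermitian_mat_def)
  have "\<exists>U\<in>unitary_set n. \<forall>k<j. \<exists>c. (mat_adjoint U * A * U) *\<^sub>v unit_vec n k = c \<cdot>\<^sub>v unit_vec n k"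
    if "j \<le> n" for j
    using that
  proof (induction j)
    case 0
    show ?case using unitary_set_one by auto
  next
    case (Suc j)
    then obtain U where U: "U \<in> unitary_set n"
      and eig: "\<forall>k<j. \<exists>c. (mat_adjoint U * A * U) *\<^sub>v unit_vec n k = c \<cdot>\<^sub>v unit_vec n k"
      by auto
    note u = unitary_setD[OF U]
    define A' where "A' = mat_adjoint U * A * U"
    have A': "hermitian_mat n A'" unfolding A'_def by (rule conjugate_hermitian[OF A u(1)])
    have A'c: "A' \<in> carrier_mat n n" using A' by (simp add: hermitian_mat_def)
    obtain r e where r: "r \<in> carrier_vec n" "r \<bullet>c r = 1" "\<And>k. k < j \<Longrightarrow> r $ k = 0" "A' *\<^sub>v r = e \<cdot>\<^sub>v r"
      using hermitian_block_eigenvector[OF A' _ eig[folded A'_def]] Suc.prems by (metis Suc_le_eq)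
    define H where "H = householder n j r"
    have jn: "j < n" using Suc.prems by simp
    have H: "H \<in> unitary_set n" unfolding H_def by (rule householder_unitary[OF r(1,2) jn])
    note h = unitary_setD[OF H]
    have eq: "mat_adjoint (U * H) * A * (U * H) = mat_adjoint H * A' * H"
      unfolding A'_def using u h Ac
      by (simp add: mat_adjoint_mult[of _ n n _ n] assoc_mult_mat[of _ n n _ n _ n] mult_carrier_mat[of _ n n _ n])
    \<comment> \<open>Conjugation pulls eigenvectors back through \<open>H\<close>: taking
      \<open>r\<close> for \<open>x\<close> treats e_j, and taking e_k for \<open>x\<close> treats
      the earlier basis vectors.\<close>
    have *: "(mat_adjoint H * A' * H) *\<^sub>v unit_vec n k = c \<cdot>\<^sub>v unit_vec n k"
      if k: "k < n" and x: "H *\<^sub>v unit_vec n k = x" "A' *\<^sub>v x = c \<cdot>\<^sub>v x" for k x c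
    proof -
      have xc: "x \<in> carrier_vec n" using x(1) h(1) by auto
      have "(mat_adjoint H * A' * H) *\<^sub>v unit_vec n k = mat_adjoint H *\<^sub>v (A' *\<^sub>v (H *\<^sub>v unit_vec n k))"
        by (rule mult3_mat_vec[OF mat_adjoint_carrier[OF h(1)] A'c h(1) unit_vec_carrier])
      also have "\<dots> = c \<cdot>\<^sub>v (mat_adjoint H *\<^sub>v (H *\<^sub>v unit_vec n k))"
        unfolding x(1) x(2) using h xc by (simp add: mult_mat_vec[of _ n n])
      also have "mat_adjoint H *\<^sub>v (H *\<^sub>v unit_vec n k) = unit_vec n k"
        by (rule unitary_adjoint_cancel_vec(1)[OF H unit_vec_carrier])
      finally show ?thesis .
    qed
    have "\<exists>c. (mat_adjoint H * A' * H) *\<^sub>v unit_vec n k = c \<cdot>\<^sub>v unit_vec n k" if "k < Suc j" for k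
    proof (cases "k = j")
      case True
      then show ?thesis
        using *[of k r e] householder_unit_vec[OF r(1,2) jn] r(4) jn by (auto simp: H_def)
    next
      case False
      then have k: "k < j" using that by simp
      then have "H *\<^sub>v unit_vec n k = unit_vec n k"
        unfolding H_def using r jn by (intro householder_fixes_unit_vec) auto
      moreover obtain c where "A' *\<^sub>v unit_vec n k = c \<cdot>\<^sub>v unit_vec n k"
        using eig[folded A'_def] k by blast
      ultimately show ?thesis
        using *[of k "unit_vec n k" c] k jn by auto
    qed
    then show ?case
      using unitary_set_mult[OF U H] unfolding eq[symmetric] by blast
  qed
  from this[of n] obtain U where U: "U \<in> unitary_set n"
    and eig: "\<And>k. k < n \<Longrightarrow> \<exists>c. (mat_adjoint U * A * U) *\<^sub>v unit_vec n k = c \<cdot>\<^sub>v unit_vec n k"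
    by auto
  define D where "D = mat_adjoint U * A * U"
  have D: "hermitian_mat n D" unfolding D_def using conjugate_hermitian[OF A] unitary_setD[OF U] by blast
  then have Dc: "D \<in> carrier_mat n n" and Dh: "mat_adjoint D = D" by (auto simp: hermitian_mat_def)
  have "D = real_diag_mat n (\<lambda>i. Re (D $$ (i, i)))"
  proof (rule eq_matI)
    fix i k assume "i < dim_row (real_diag_mat n (\<lambda>i. Re (D $$ (i, i))))" "k < dim_col (real_diag_mat n (\<lambda>i. Re (D $$ (i, i))))"
    then have ik: "i < n" "k < n" by (auto simp: real_diag_mat_def)
    obtain c where c: "D *\<^sub>v unit_vec n k = c \<cdot>\<^sub>v unit_vec n k"
      using eig[OF ik(2)] unfolding D_def by blast
    have "D $$ (i, k) = (D *\<^sub>v unit_vec n k) $ i"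
      using ik Dc by (subst index_mult_mat_vec_sum[of _ n n]) (auto simp: if_distrib cong: if_cong)
    then have off: "D $$ (i, k) = (if i = k then c else 0)" unfolding c using ik by simp
    \<comment> \<open>Up to here the eigenvalues are complex numbers; hermitian symmetry of
      \<open>D\<close> makes them real.\<close>
    have "D $$ (i, i) = cnj (D $$ (i, i))"
      using Dc ik by (subst Dh[symmetric]) simp
    then have "D $$ (i, i) = complex_of_real (Re (D $$ (i, i)))"
      by (simp add: complex_eq_iff)
    then show "D $$ (i, k) = real_diag_mat n (\<lambda>i. Re (D $$ (i, i))) $$ (i, k)"
      using off ik by (auto simp: real_diag_mat_def)
  qed (use Dc in \<open>auto simp: real_diag_mat_def\<close>)
  then show ?thesis using that U D_def by metis
qed

section \<open>Spectral quantities read off from a diagonalization\<close>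

context
  fixes n :: nat and A U :: "complex mat" and d :: "nat \<Rightarrow> real"
  assumes A: "A \<in> carrier_mat n n" and U: "U \<in> unitary_set n"
    and D: "mat_adjoint U * A * U = real_diag_mat n d"
begin

text \<open>Unitary conjugation is a similarity, so the characteristic polynomial is that of the
  diagonal matrix, and counting roots with multiplicity becomes counting indices.\<close>

lemma esd_cdf_diagonalized: "esd_cdf A x = real (card {i. i < n \<and> d i \<le> x}) / real n"
proof -
  note u = unitary_setD[OF U]
  have "similar_mat_wit (real_diag_mat n d) A (mat_adjoint U) U"
    by (rule similar_mat_witI[of _ _ n]) (use u A D in auto)
  then have "char_poly A = char_poly (real_diag_mat n d)"
    using char_poly_similar unfolding similar_mat_def by metis
  also have "\<dots> = (\<Prod>a\<leftarrow>diag_mat (real_diag_mat n d). [:- a, 1:])"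
    by (rule char_poly_upper_triangular[OF real_diag_mat_carrier])
       (auto simp: upper_triangular_def real_diag_mat_def)
  also have "diag_mat (real_diag_mat n d) = map (\<lambda>i. complex_of_real (d i)) [0..<n]"
    by (auto simp: diag_mat_def real_diag_mat_def)
  finally have "char_poly A = (\<Prod>i\<leftarrow>[0..<n]. [:- complex_of_real (d i), 1:])"
    by (simp add: o_def)
  also have "\<dots> = (\<Prod>i\<in>{..<n}. [:- complex_of_real (d i), 1:])"
    using prod.distinct_set_conv_list[of "[0..<n]" "\<lambda>i. [:- complex_of_real (d i), 1:]"]
    by (simp add: lessThan_atLeast0)
  finally have "proots (char_poly A) = (\<Sum>i\<in>{..<n}. {#complex_of_real (d i)#})"
    by (simp add: proots_prod)
  also have "\<dots> = image_mset (\<lambda>i. complex_of_real (d i)) (mset_set {..<n})"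
    by (induction n) (auto simp: lessThan_Suc)
  finally have "size (filter_mset (\<lambda>z. Re z \<le> x) (proots (char_poly A))) = card {i \<in> {..<n}. d i \<le> x}"
    by (simp add: filter_mset_image_mset)
  then show ?thesis using A by (simp add: esd_cdf_def)
qed

lemma quadratic_form_diagonalized:
  assumes v: "v \<in> carrier_vec n"
  shows "(A *\<^sub>v v) \<bullet>c v = complex_of_real (\<Sum>i<n. d i * (cmod ((mat_adjoint U *\<^sub>v v) $ i))\<^sup>2)"
proof -
  note u = unitary_setD[OF U]
  define w where "w = mat_adjoint U *\<^sub>v v"
  have w: "w \<in> carrier_vec n" using mult_mat_vec_carrier[OF mat_adjoint_carrier[OF u(1)] v] by (simp add: w_def)
  have vw: "v = U *\<^sub>v w"
    unfolding w_def by (rule unitary_adjoint_cancel_vec(2)[OF U v, symmetric])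
  have "(A *\<^sub>v v) \<bullet>c (U *\<^sub>v w) = (mat_adjoint U *\<^sub>v (A *\<^sub>v v)) \<bullet>c w"
    using cscalar_prod_mult_mat_vec[of "mat_adjoint U" n n "A *\<^sub>v v" w] u v w A by simp
  also have "mat_adjoint U *\<^sub>v (A *\<^sub>v v) = real_diag_mat n d *\<^sub>v w"
    unfolding D[symmetric] vw by (rule mult3_mat_vec[OF mat_adjoint_carrier[OF u(1)] A u(1) w, symmetric])
  also have "(real_diag_mat n d *\<^sub>v w) \<bullet>c w = (\<Sum>i<n. complex_of_real (d i) * (w $ i * cnj (w $ i)))"
    unfolding cscalar_prod_sum[OF w]
  proof (intro sum.cong refl)
    fix i assume "i \<in> {..<n}"
    then show "(real_diag_mat n d *\<^sub>v w) $ i * cnj (w $ i) = complex_of_real (d i) * (w $ i * cnj (w $ i))"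
      using w by (subst index_mult_mat_vec_sum[of _ n n])
        (auto simp: real_diag_mat_def if_distrib[of "\<lambda>x. x * _"] cong: if_cong)
  qed
  also have "\<dots> = complex_of_real (\<Sum>i<n. d i * (cmod (w $ i))\<^sup>2)"
    by (simp add: complex_norm_square del: of_real_power)
  finally show ?thesis unfolding w_def[symmetric] vw[symmetric] .
qed

text \<open>Traces of powers are polynomial in the entries. Through them symmetric functions of the
  eigenvalues become measurable in the matrix, although no measurable choice of \<open>U\<close> and
  \<open>d\<close> is made.\<close>

lemma trace_power_diagonalized:
  "(\<Sum>i<n. (A ^\<^sub>m k) $$ (i, i)) = complex_of_real (\<Sum>i<n. d i ^ k)"
proof -
  note u = unitary_setD[OF U]
  have Ak: "A ^\<^sub>m k \<in> carrier_mat n n" for k using A by simp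
  have "mat_adjoint U * A ^\<^sub>m k * U = real_diag_mat n (\<lambda>i. d i ^ k)" for k
  proof (induction k)
    case 0
    show ?case using u A by (auto simp: real_diag_mat_def intro!: eq_matI)
  next
    case (Suc k)
    have "mat_adjoint U * A ^\<^sub>m Suc k * U = (mat_adjoint U * A ^\<^sub>m k) * (A * U)"
      using u A Ak[of k] by (simp add: assoc_mult_mat[of _ n n _ n _ n] mult_carrier_mat[of _ n n _ n])
    \<comment> \<open>The identity is inserted as \<open>U\<close> times its adjoint, so that each
      of the two factors is conjugated separately.\<close>
    also have "\<dots> = (mat_adjoint U * A ^\<^sub>m k) * (U * (mat_adjoint U * (A * U)))"
      using unitary_adjoint_cancel(2)[OF U mult_carrier_mat[OF A u(1)]] by simp
    also have "\<dots> = (mat_adjoint U * A ^\<^sub>m k * U) * (mat_adjoint U * A * U)"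
      using u A Ak[of k] by (simp add: assoc_mult_mat[of _ n n _ n _ n] mult_carrier_mat[of _ n n _ n])
    also have "\<dots> = real_diag_mat n (\<lambda>i. d i ^ k) * real_diag_mat n d"
      unfolding Suc.IH D ..
    also have "\<dots> = real_diag_mat n (\<lambda>i. d i ^ Suc k)"
    proof (rule eq_matI)
      fix i l assume "i < dim_row (real_diag_mat n (\<lambda>i. d i ^ Suc k))" "l < dim_col (real_diag_mat n (\<lambda>i. d i ^ Suc k))"
      then have il: "i < n" "l < n" by (auto simp: real_diag_mat_def)
      show "(real_diag_mat n (\<lambda>i. d i ^ k) * real_diag_mat n d) $$ (i, l) = real_diag_mat n (\<lambda>i. d i ^ Suc k) $$ (i, l)"
        using il by (subst index_mult_mat_sum[of _ n n _ n])
          (auto simp: real_diag_mat_def if_distrib[of "\<lambda>x. x * _"] mult.commute cong: if_cong)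
    qed (auto simp: real_diag_mat_def)
    finally show ?case .
  qed
  note Dk = this
  have "(\<Sum>i<n. (A ^\<^sub>m k) $$ (i, i)) = (\<Sum>i<n. (A ^\<^sub>m k * U * mat_adjoint U) $$ (i, i))"
    using u Ak[of k] by (simp add: right_mult_one_mat[OF Ak] assoc_mult_mat[of _ n n _ n _ n] mult_carrier_mat[of _ n n _ n])
  also have "\<dots> = (\<Sum>i<n. \<Sum>l<n. (A ^\<^sub>m k * U) $$ (i, l) * mat_adjoint U $$ (l, i))"
    using u Ak[of k] by (intro sum.cong refl index_mult_mat_sum[of _ n n _ n]) auto
  also have "\<dots> = (\<Sum>l<n. \<Sum>i<n. mat_adjoint U $$ (l, i) * (A ^\<^sub>m k * U) $$ (i, l))"
    by (subst sum.swap) (simp add: mult.commute)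
  also have "\<dots> = (\<Sum>l<n. (mat_adjoint U * (A ^\<^sub>m k * U)) $$ (l, l))"
    using u Ak[of k] by (intro sum.cong refl index_mult_mat_sum[of _ n n _ n, symmetric]) auto
  also have "\<dots> = (\<Sum>l<n. real_diag_mat n (\<lambda>i. d i ^ k) $$ (l, l))"
    using u Ak[of k] by (simp add: Dk[symmetric] assoc_mult_mat[of _ n n _ n _ n] mult_carrier_mat[of _ n n _ n])
  also have "\<dots> = complex_of_real (\<Sum>i<n. d i ^ k)"
    by (simp add: real_diag_mat_def)
  finally show ?thesis .
qed

end

text \<open>Min-max by counting constraints. If the counts differed by more than 2, the eigenvectors
  of \<open>A\<close> above \<open>x\<close>, those of \<open>B\<close> at or below
  \<open>x\<close>, and \<open>a\<close> and \<open>b\<close> would be fewer than \<open>n\<close>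
  vectors, so some nonzero \<open>v\<close> would be orthogonal to all of them. Its form would be at
  most \<open>x\<close> times the squared norm for \<open>A\<close> and larger than that for
  \<open>B\<close>, although the two forms agree at \<open>v\<close>.\<close>

lemma esd_cdf_le_of_forms_agree:
  assumes A: "hermitian_mat n A" and B: "hermitian_mat n B" and n: "n > 0"
    and ab: "a \<in> carrier_vec n" "b \<in> carrier_vec n"
    and agree: "\<And>v. v \<in> carrier_vec n \<Longrightarrow> v \<bullet>c a = 0 \<Longrightarrow> v \<bullet>c b = 0 \<Longrightarrow>
      (A *\<^sub>v v) \<bullet>c v = (B *\<^sub>v v) \<bullet>c v"
  shows "esd_cdf A x \<le> esd_cdf B x + 2 / real n"
proof -
  have c: "A \<in> carrier_mat n n" "B \<in> carrier_mat n n" using A B by (auto simp: hermitian_mat_def)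
  obtain U d where U: "U \<in> unitary_set n" "mat_adjoint U * A * U = real_diag_mat n d"
    by (rule hermitian_diagonalization[OF A])
  obtain V f where V: "V \<in> unitary_set n" "mat_adjoint V * B * V = real_diag_mat n f"
    by (rule hermitian_diagonalization[OF B])
  have coord: "(mat_adjoint W *\<^sub>v v) $ i = v \<bullet>c (W *\<^sub>v unit_vec n i)"
    if "W \<in> unitary_set n" "v \<in> carrier_vec n" "i < n" for W v i
    using that unitary_setD[OF that(1)]
    by (subst cscalar_prod_mult_mat_vec[of "mat_adjoint W" n n v "unit_vec n i", simplified, symmetric])
       (auto simp: cscalar_prod_sum[of _ n] if_distrib cong: if_cong)
  have norm: "complex_of_real (\<Sum>i<n. (cmod ((mat_adjoint W *\<^sub>v v) $ i))\<^sup>2) = v \<bullet>c v"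
    if "W \<in> unitary_set n" "v \<in> carrier_vec n" for W v
    using unitary_norm[OF unitary_set_adjoint[OF that(1)] that(2)]
      cnorm_square[OF mult_mat_vec_carrier[OF mat_adjoint_carrier[OF unitary_setD(1)[OF that(1)]] that(2)]]
    by simp
  let ?I = "{i. i < n \<and> d i \<le> x}" and ?J = "{i. i < n \<and> f i \<le> x}"
  let ?S = "(\<lambda>i. U *\<^sub>v unit_vec n i) ` {i. i < n \<and> d i > x} \<union> (\<lambda>i. V *\<^sub>v unit_vec n i) ` ?J \<union> {a, b}"
  have "card ?I \<le> card ?J + 2"
  proof (rule ccontr)
    assume less: "\<not> card ?I \<le> card ?J + 2"
    have "card ?I + card {i. i < n \<and> d i > x} = card (?I \<union> {i. i < n \<and> d i > x})"
      by (rule card_Un_disjoint[symmetric]) auto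
    also have "?I \<union> {i. i < n \<and> d i > x} = {..<n}" by auto
    finally have compl: "card ?I + card {i. i < n \<and> d i > x} = n" by simp
    have "card ?S \<le> card {i. i < n \<and> d i > x} + card ?J + 2"
      by (intro order.trans[OF card_Un_le] add_mono card_image_le) (auto simp: card_insert_if)
    then have card: "card ?S < n" using less compl by linarith
    have "?S \<subseteq> carrier_vec n"
      using ab unitary_setD[OF U(1)] unitary_setD[OF V(1)] by auto
    then obtain v where v: "v \<in> carrier_vec n" "v \<noteq> 0\<^sub>v n" "\<And>s. s \<in> ?S \<Longrightarrow> v \<bullet>c s = 0"
      using exists_nonzero_orthogonal[of ?S n] card by auto
    define p where "p i = (cmod ((mat_adjoint U *\<^sub>v v) $ i))\<^sup>2" for i
    define q where "q i = (cmod ((mat_adjoint V *\<^sub>v v) $ i))\<^sup>2" for i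
    have p0: "p i = 0" if "i < n" "d i > x" for i
    proof -
      have "U *\<^sub>v unit_vec n i \<in> ?S" using that by blast
      from v(3)[OF this] show ?thesis using coord[OF U(1) v(1) that(1)] by (simp add: p_def)
    qed
    have q0: "q i = 0" if "i < n" "f i \<le> x" for i
    proof -
      have "V *\<^sub>v unit_vec n i \<in> ?S" using that by blast
      from v(3)[OF this] show ?thesis using coord[OF V(1) v(1) that(1)] by (simp add: q_def)
    qed
    have "(A *\<^sub>v v) \<bullet>c v = (B *\<^sub>v v) \<bullet>c v"
      by (rule agree[OF v(1)]) (simp_all add: v(3))
    then have eq: "(\<Sum>i<n. d i * p i) = (\<Sum>i<n. f i * q i)"
      unfolding quadratic_form_diagonalized[OF c(1) U v(1)] quadratic_form_diagonalized[OF c(2) V v(1)]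
        p_def q_def of_real_eq_iff .
    have "complex_of_real (sum p {..<n}) = v \<bullet>c v"
      unfolding p_def by (rule norm[OF U(1) v(1)])
    then have "complex_of_real (sum p {..<n}) = complex_of_real (sum q {..<n})"
      using norm[OF V(1) v(1)] unfolding q_def by (rule trans[OF _ sym])
    then have pq: "sum p {..<n} = sum q {..<n}"
      unfolding of_real_eq_iff .
    have vq: "complex_of_real (sum q {..<n}) = v \<bullet>c v"
      unfolding q_def by (rule norm[OF V(1) v(1)])
    have "sum q {..<n} \<noteq> 0"
      using vq conjugate_square_eq_0_vec[OF v(1)] v(2) by (metis of_real_0)
    then obtain i where i: "i < n" "q i \<noteq> 0" by (metis lessThan_iff sum.neutral)
    have "(\<Sum>i<n. d i * p i) \<le> (\<Sum>i<n. x * p i)"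
    proof (rule sum_mono)
      fix i assume "i \<in> {..<n}"
      then show "d i * p i \<le> x * p i"
        using p0[of i] by (cases "d i > x") (auto simp: p_def intro!: mult_right_mono)
    qed
    also have "\<dots> = (\<Sum>i<n. x * q i)" unfolding sum_distrib_left[symmetric] pq ..
    \<comment> \<open>Strictness falls on the side of \<open>B\<close>: the eigenvalues that survive
      exceed \<open>x\<close>, and one of them has positive weight because \<open>v\<close> is
      nonzero.\<close>
    also have "\<dots> < (\<Sum>i<n. f i * q i)"
    proof (rule sum_strict_mono_ex1)
      show "\<forall>i\<in>{..<n}. x * q i \<le> f i * q i"
      proof
        fix i assume "i \<in> {..<n}"
        then show "x * q i \<le> f i * q i"
          using q0[of i] by (cases "f i \<le> x") (auto simp: q_def intro!: mult_right_mono)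
      qed
      have "f i > x" using q0[of i] i by force
      moreover have "q i > 0" using i by (simp add: q_def)
      ultimately show "\<exists>i\<in>{..<n}. x * q i < f i * q i"
        using i by (intro bexI[of _ i] mult_strict_right_mono) auto
    qed simp
    finally show False using eq by simp
  qed
  then have "real (card ?I) \<le> real (card ?J) + 2" by linarith
  then have "real (card ?I) / real n \<le> (real (card ?J) + 2) / real n"
    using n by (intro divide_right_mono) auto
  then show ?thesis
    unfolding esd_cdf_diagonalized[OF c(1) U] esd_cdf_diagonalized[OF c(2) V] by (simp add: add_divide_distrib)
qed

lemma esd_cdf_abs_le_one:
  assumes "hermitian_mat n A"
  shows "\<bar>esd_cdf A x\<bar> \<le> 1"
proof -
  have c: "A \<in> carrier_mat n n" using assms by (auto simp: hermitian_mat_def)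
  obtain U d where U: "U \<in> unitary_set n" "mat_adjoint U * A * U = real_diag_mat n d"
    by (rule hermitian_diagonalization[OF assms])
  have "card {i. i < n \<and> d i \<le> x} \<le> card {..<n}" by (rule card_mono) auto
  then show ?thesis
    unfolding esd_cdf_diagonalized[OF c U] by (auto simp: divide_le_eq_1)
qed

section \<open>Sensitivity of the distribution function to one rotation\<close>

lemma rotated_sum_hermitian:
  assumes "hermitian_mat n M" "hermitian_mat n N" "U \<in> carrier_mat n n" "V \<in> carrier_mat n n"
  shows "hermitian_mat n (U * M * mat_adjoint U + V * N * mat_adjoint V)"
  using conjugate_hermitian(2)[OF assms(1,3)] conjugate_hermitian(2)[OF assms(2,4)]
  by (auto simp: hermitian_mat_def mat_adjoint_add[of _ n n])

lemma rotated_sum_form: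
  assumes "hermitian_mat n M" "hermitian_mat n N" "U \<in> carrier_mat n n" "V \<in> carrier_mat n n" "v \<in> carrier_vec n"
  shows "((U * M * mat_adjoint U + V * N * mat_adjoint V) *\<^sub>v v) \<bullet>c v =
    (M *\<^sub>v (mat_adjoint U *\<^sub>v v)) \<bullet>c (mat_adjoint U *\<^sub>v v) +
    (N *\<^sub>v (mat_adjoint V *\<^sub>v v)) \<bullet>c (mat_adjoint V *\<^sub>v v)"
proof -
  have *: "((X * K * mat_adjoint X) *\<^sub>v v) \<bullet>c v = (K *\<^sub>v (mat_adjoint X *\<^sub>v v)) \<bullet>c (mat_adjoint X *\<^sub>v v)"
    if X: "X \<in> carrier_mat n n" and K: "K \<in> carrier_mat n n" for X K
  proof -
    have "mat_adjoint X *\<^sub>v v \<in> carrier_vec n"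
      by (rule mult_mat_vec_carrier[OF mat_adjoint_carrier[OF X] assms(5)])
    then have "K *\<^sub>v (mat_adjoint X *\<^sub>v v) \<in> carrier_vec n"
      by (rule mult_mat_vec_carrier[OF K])
    then show ?thesis
      unfolding mult3_mat_vec[OF X K mat_adjoint_carrier[OF X] assms(5)]
      by (rule cscalar_prod_mult_mat_vec[OF X _ assms(5)])
  qed
  have MN: "M \<in> carrier_mat n n" "N \<in> carrier_mat n n" using assms by (auto simp: hermitian_mat_def)
  have "((U * M * mat_adjoint U + V * N * mat_adjoint V) *\<^sub>v v) \<bullet>c v =
      ((U * M * mat_adjoint U) *\<^sub>v v) \<bullet>c v + ((V * N * mat_adjoint V) *\<^sub>v v) \<bullet>c v"
    using MN assms by (subst add_mult_distrib_mat_vec[of _ n n])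
      (auto intro!: add_scalar_prod_distrib mult_mat_vec_carrier[of _ n n] mult_carrier_mat[of _ n n])
  then show ?thesis using * MN assms by simp
qed

lemma esd_cdf_nearby_left:
  assumes "hermitian_mat n M" "hermitian_mat n N" "n > 0"
    "U \<in> carrier_mat n n" "U' \<in> carrier_mat n n" "V \<in> carrier_mat n n" "nearby n U U'"
  shows "\<bar>esd_cdf (U * M * mat_adjoint U + V * N * mat_adjoint V) x -
    esd_cdf (U' * M * mat_adjoint U' + V * N * mat_adjoint V) x\<bar> \<le> 2 / real n"
proof -
  obtain a b where ab: "a \<in> carrier_vec n" "b \<in> carrier_vec n"
    "\<And>v. v \<in> carrier_vec n \<Longrightarrow> v \<bullet>c a = 0 \<Longrightarrow> v \<bullet>c b = 0 \<Longrightarrow> mat_adjoint U *\<^sub>v v = mat_adjoint U' *\<^sub>v v"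
    using assms(7) unfolding nearby_def by blast
  note H = rotated_sum_hermitian[OF assms(1,2,4,6)] rotated_sum_hermitian[OF assms(1,2,5,6)]
  have "((U * M * mat_adjoint U + V * N * mat_adjoint V) *\<^sub>v v) \<bullet>c v =
      ((U' * M * mat_adjoint U' + V * N * mat_adjoint V) *\<^sub>v v) \<bullet>c v"
    if "v \<in> carrier_vec n" "v \<bullet>c a = 0" "v \<bullet>c b = 0" for v
    using rotated_sum_form[OF assms(1,2,4,6) that(1)] rotated_sum_form[OF assms(1,2,5,6) that(1)] ab(3)[OF that]
    by simp
  then show ?thesis
    using esd_cdf_le_of_forms_agree[OF H(1,2) assms(3) ab(1,2), of x]
      esd_cdf_le_of_forms_agree[OF H(2,1) assms(3) ab(1,2), of x] by auto
qed

lemma esd_cdf_nearby_right: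
  assumes "hermitian_mat n M" "hermitian_mat n N" "n > 0"
    "U \<in> carrier_mat n n" "V \<in> carrier_mat n n" "V' \<in> carrier_mat n n" "nearby n V V'"
  shows "\<bar>esd_cdf (U * M * mat_adjoint U + V * N * mat_adjoint V) x -
    esd_cdf (U * M * mat_adjoint U + V' * N * mat_adjoint V') x\<bar> \<le> 2 / real n"
proof -
  have "U * M * mat_adjoint U + W * N * mat_adjoint W = W * N * mat_adjoint W + U * M * mat_adjoint U"
    if "W \<in> carrier_mat n n" for W
    using assms that by (intro comm_add_mat[of _ n n]) (auto simp: hermitian_mat_def)
  then show ?thesis
    using esd_cdf_nearby_left[OF assms(2,1,3,5,6,4,7), of x] assms(5,6) by simp
qed

subsection \<open>Subgaussian random variables\<close>

text \<open>The nonnegative integral keeps the bound meaningful before integrability of the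
  exponential is known. With the exponent \<open>s\<^sup>2 * v\<close>, the parameter
  \<open>v\<close> is half the usual variance proxy. All real \<open>s\<close> are included, so both
  tails are controlled.\<close>

definition subgaussian :: "'a measure \<Rightarrow> ('a \<Rightarrow> real) \<Rightarrow> real \<Rightarrow> bool" where
  "subgaussian M f v \<longleftrightarrow>
     (\<forall>s. (\<integral>\<^sup>+x. ennreal (exp (s * (f x - (\<integral>y. f y \<partial>M)))) \<partial>M) \<le> ennreal (exp (s\<^sup>2 * v)))"

lemma subgaussian_of_bounded:
  assumes "prob_space M" and [measurable]: "f \<in> borel_measurable M"
    and f: "AE x in M. f x \<in> {a..a + c}"
  shows "subgaussian M f (c\<^sup>2 / 8)"
proof -
  interpret M: prob_space M by fact
  interpret f: interval_bounded_random_variable M f a "a + c"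
    by unfold_locales (use f in auto)
  \<comment> \<open>Hoeffding's lemma is applied with positive parameters; negative \<open>s\<close>
    is covered by \<open>- f\<close> with parameter \<open>- s\<close>.\<close>
  interpret g: interval_bounded_random_variable M "\<lambda>x. - f x" "- (a + c)" "- a"
    by unfold_locales (use f in auto)
  have "(\<integral>\<^sup>+x. ennreal (exp (s * (f x - (\<integral>y. f y \<partial>M)))) \<partial>M) \<le> ennreal (exp (s\<^sup>2 * (c\<^sup>2 / 8)))" for s
  proof (cases s "0 :: real" rule: linorder_cases)
    case less
    then show ?thesis
      using g.Hoeffdings_lemma_nn_integral[of "- s"] by (simp add: algebra_simps)
  next
    case equal
    then show ?thesis by (simp add: M.emeasure_space_1)
  next
    case greater
    then show ?thesis
      using f.Hoeffdings_lemma_nn_integral[of s] by simp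
  qed
  then show ?thesis unfolding subgaussian_def by blast
qed

lemma subgaussian_of_AE_const:
  assumes "prob_space M" and [measurable]: "f \<in> borel_measurable M" and "AE x in M. f x = a"
  shows "subgaussian M f 0"
  using subgaussian_of_bounded[of M f a 0] assms by simp

text \<open>One martingale step: the deviation of \<open>F\<close> splits into the fluctuation
  within the fibre over \<open>x\<close> and the fluctuation of the fibre mean. The first
  exponential is integrated out with a bound that does not depend on \<open>x\<close>, so the two
  constants add.\<close>

lemma subgaussian_fibres:
  assumes M: "prob_space M" and N: "prob_space N"
    and F [measurable]: "F \<in> borel_measurable (M \<Otimes>\<^sub>M N)"
    and B: "\<And>z. z \<in> space (M \<Otimes>\<^sub>M N) \<Longrightarrow> \<bar>F z\<bar> \<le> B"
    and fibre: "AE x in M. subgaussian N (\<lambda>y. F (x, y)) v"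
    and mean: "subgaussian M (\<lambda>x. \<integral>y. F (x, y) \<partial>N) w"
  shows "subgaussian (M \<Otimes>\<^sub>M N) F (v + w)"
proof -
  interpret M: prob_space M by fact
  interpret N: prob_space N by fact
  interpret P: pair_prob_space M N ..
  define m where "m x = (\<integral>y. F (x, y) \<partial>N)" for x
  have [measurable]: "m \<in> borel_measurable M" unfolding m_def by measurable
  define e where "e = (\<integral>z. F z \<partial>(M \<Otimes>\<^sub>M N))"
  have "integrable (M \<Otimes>\<^sub>M N) F"
    by (rule P.P.integrable_const_bound[where B = B]) (use B in auto)
  then have e: "(\<integral>x. m x \<partial>M) = e" unfolding m_def e_def by (rule P.integral_fst')
  have "(\<integral>\<^sup>+z. ennreal (exp (s * (F z - e))) \<partial>(M \<Otimes>\<^sub>M N)) \<le> ennreal (exp (s\<^sup>2 * (v + w)))" for s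
  proof -
    have "(\<integral>\<^sup>+z. ennreal (exp (s * (F z - e))) \<partial>(M \<Otimes>\<^sub>M N)) =
        (\<integral>\<^sup>+x. \<integral>\<^sup>+y. ennreal (exp (s * (F (x, y) - e))) \<partial>N \<partial>M)"
      by (rule N.nn_integral_fst[symmetric]) measurable
    also have "\<dots> \<le> (\<integral>\<^sup>+x. ennreal (exp (s\<^sup>2 * v)) * ennreal (exp (s * (m x - e))) \<partial>M)"
    proof (rule nn_integral_mono_AE, use fibre AE_space in eventually_elim)
      case (elim x)
      have [measurable]: "x \<in> space M" by fact
      have "(\<integral>\<^sup>+y. ennreal (exp (s * (F (x, y) - e))) \<partial>N) =
          (\<integral>\<^sup>+y. ennreal (exp (s * (m x - e))) * ennreal (exp (s * (F (x, y) - m x))) \<partial>N)"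
        by (intro nn_integral_cong) (simp add: ennreal_mult[symmetric] exp_add[symmetric] algebra_simps)
      also have "\<dots> = ennreal (exp (s * (m x - e))) * (\<integral>\<^sup>+y. ennreal (exp (s * (F (x, y) - m x))) \<partial>N)"
        by (rule nn_integral_cmult) measurable
      also have "\<dots> \<le> ennreal (exp (s * (m x - e))) * ennreal (exp (s\<^sup>2 * v))"
        using elim unfolding subgaussian_def m_def by (intro mult_left_mono) auto
      finally show ?case by (simp add: mult.commute)
    qed
    also have "\<dots> = ennreal (exp (s\<^sup>2 * v)) * (\<integral>\<^sup>+x. ennreal (exp (s * (m x - e))) \<partial>M)"
      by (rule nn_integral_cmult) measurable
    also have "\<dots> \<le> ennreal (exp (s\<^sup>2 * v)) * ennreal (exp (s\<^sup>2 * w))"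
      using mean unfolding subgaussian_def m_def[symmetric] e by (intro mult_left_mono) auto
    also have "\<dots> = ennreal (exp (s\<^sup>2 * (v + w)))"
      by (simp add: ennreal_mult[symmetric] exp_add[symmetric] algebra_simps)
    finally show ?thesis .
  qed
  then show ?thesis unfolding subgaussian_def e_def[symmetric] by blast
qed

section \<open>Tail and variance bounds from the moment generating function\<close>

lemma subgaussian_tail:
  assumes "prob_space M" and [measurable]: "f \<in> borel_measurable M"
    and sub: "subgaussian M f v" and v: "v > 0" and t: "t \<ge> 0"
  shows "measure M {x \<in> space M. \<bar>f x - (\<integral>y. f y \<partial>M)\<bar> \<ge> t} \<le> 2 * exp (- t\<^sup>2 / (4 * v))"
proof (cases "t = 0")
  case True
  interpret M: prob_space M by fact
  show ?thesis using True M.prob_le_1[of "space M"] by (auto intro: order.trans[OF M.prob_le_1])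
next
  case False
  interpret M: prob_space M by fact
  define X where "X x = f x - (\<integral>y. f y \<partial>M)" for x
  have X [measurable]: "X \<in> borel_measurable M" unfolding X_def by measurable
  \<comment> \<open>The minimizer of \<open>- s * t + s\<^sup>2 * v\<close>. The exponential Markov
    inequality needs it positive, which is why \<open>t = 0\<close> is treated separately.\<close>
  define s where "s = t / (2 * v)"
  have s: "s > 0" using False t v by (simp add: s_def)
  have st: "- s * t + s\<^sup>2 * v = - t\<^sup>2 / (4 * v)"
    using v by (simp add: s_def field_simps power2_eq_square)
  have one_sided: "measure M {x \<in> space M. c * X x \<ge> t} \<le> exp (- t\<^sup>2 / (4 * v))"
    if c: "c = 1 \<or> c = - 1" for c :: real
  proof -
    have "emeasure M {x \<in> space M. c * X x \<ge> t} \<le>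
        ennreal (exp (- s * t)) * (\<integral>\<^sup>+x. ennreal (exp (s * (c * X x))) * indicator (space M) x \<partial>M)"
      by (rule Chernoff_ineq_nn_integral_ge[OF s]) auto
    also have "(\<integral>\<^sup>+x. ennreal (exp (s * (c * X x))) * indicator (space M) x \<partial>M) =
        (\<integral>\<^sup>+x. ennreal (exp ((s * c) * X x)) \<partial>M)"
      by (intro nn_integral_cong) (simp add: mult.assoc)
    also have "\<dots> \<le> ennreal (exp ((s * c)\<^sup>2 * v))"
      using sub unfolding subgaussian_def X_def by blast
    also have "(s * c)\<^sup>2 = s\<^sup>2" using c by auto
    also have "ennreal (exp (- s * t)) * ennreal (exp (s\<^sup>2 * v)) = ennreal (exp (- t\<^sup>2 / (4 * v)))"
      unfolding st[symmetric] by (simp add: ennreal_mult[symmetric] exp_add[symmetric])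
    finally show ?thesis
      by (simp add: M.emeasure_eq_measure mult_left_mono)
  qed
  have "measure M {x \<in> space M. \<bar>X x\<bar> \<ge> t} \<le>
      measure M ({x \<in> space M. 1 * X x \<ge> t} \<union> {x \<in> space M. - 1 * X x \<ge> t})"
    by (rule M.finite_measure_mono) auto
  also have "\<dots> \<le> measure M {x \<in> space M. 1 * X x \<ge> t} + measure M {x \<in> space M. - 1 * X x \<ge> t}"
    by (rule measure_Un_le) auto
  also have "\<dots> \<le> 2 * exp (- t\<^sup>2 / (4 * v))"
    using one_sided[of 1] one_sided[of "- 1"] by simp
  finally show ?thesis unfolding X_def .
qed

text \<open>This is cosh y \<ge> 1 + y^2 / 2. The difference of the two sides is read off from the
  square of \<open>exp (y / 2) - exp (- (y / 2))\<close>, whose absolute value is at least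
  |y|.\<close>

lemma exp_add_exp_minus_ge: "2 + y\<^sup>2 \<le> exp y + exp (- y :: real)"
proof -
  have *: "2 * u \<le> exp u - exp (- u)" if u: "u \<ge> 0" for u :: real
  proof -
    have pos: "0 < 1 + u + u\<^sup>2 / 2" using u by (simp add: add_pos_nonneg)
    \<comment> \<open>As the product is at least 1, the second quadratic dominates the reciprocal of
      the first, which in turn dominates \<open>exp (- u)\<close>.\<close>
    have "(1 + u + u\<^sup>2 / 2) * (1 - u + u\<^sup>2 / 2) = 1 + (u\<^sup>2)\<^sup>2 / 4"
      by (simp add: algebra_simps power2_eq_square)
    then have "1 / (1 + u + u\<^sup>2 / 2) \<le> 1 - u + u\<^sup>2 / 2"
      using pos by (simp add: divide_le_eq mult.commute)
    moreover have "exp (- u) \<le> 1 / (1 + u + u\<^sup>2 / 2)"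
      using exp_lower_Taylor_quadratic[OF u] pos by (simp add: exp_minus field_simps)
    ultimately show ?thesis using exp_lower_Taylor_quadratic[OF u] by simp
  qed
  have "\<bar>y\<bar> \<le> \<bar>exp (y / 2) - exp (- (y / 2))\<bar>"
    using *[of "y / 2"] *[of "- (y / 2)"] by (cases "y \<ge> 0") auto
  then have "y\<^sup>2 \<le> (exp (y / 2) - exp (- (y / 2)))\<^sup>2"
    by (simp add: abs_le_square_iff)
  also have "\<dots> = exp y + exp (- y) - 2"
    by (simp add: power2_eq_square algebra_simps exp_add[symmetric])
  finally show ?thesis by simp
qed

text \<open>Adding the exponential bounds at \<open>s\<close> and \<open>- s\<close> controls the
  second moment at one fixed \<open>s\<close>. Letting \<open>s\<close> tend to 0 would give
  \<open>2 * v\<close>; the fixed choice replaces the limit at the cost of a factor 2.\<close>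

lemma subgaussian_variance:
  assumes "prob_space M" and [measurable]: "f \<in> borel_measurable M"
    and B: "\<And>x. x \<in> space M \<Longrightarrow> \<bar>f x\<bar> \<le> B"
    and sub: "subgaussian M f v" and v: "v > 0"
  shows "prob_space.variance M f \<le> 4 * v"
proof -
  interpret M: prob_space M by fact
  define e where "e = (\<integral>y. f y \<partial>M)"
  have bnd: "\<bar>s * (f x - e)\<bar> \<le> \<bar>s\<bar> * (B + \<bar>e\<bar>)" if "x \<in> space M" for s x
    unfolding abs_mult using B[OF that] by (intro mult_left_mono) auto
  have int_exp: "integrable M (\<lambda>x. exp (s * (f x - e)))" for s
    by (rule M.integrable_const_bound[where B = "exp (\<bar>s\<bar> * (B + \<bar>e\<bar>))"])
       (use bnd[of _ s] in \<open>auto simp: abs_le_iff\<close>)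
  have int_sq: "integrable M (\<lambda>x. (f x - e)\<^sup>2)"
  proof (rule M.integrable_const_bound[where B = "(B + \<bar>e\<bar>)\<^sup>2"])
    show "AE x in M. norm ((f x - e)\<^sup>2) \<le> (B + \<bar>e\<bar>)\<^sup>2"
    proof (rule AE_I2)
      fix x assume "x \<in> space M"
      then have "\<bar>f x - e\<bar> \<le> \<bar>B + \<bar>e\<bar>\<bar>" using bnd[of x 1] by simp
      then show "norm ((f x - e)\<^sup>2) \<le> (B + \<bar>e\<bar>)\<^sup>2" by (simp add: abs_le_square_iff)
    qed
  qed measurable
  have le: "(\<integral>x. exp (s * (f x - e)) \<partial>M) \<le> exp (s\<^sup>2 * v)" for s
    using sub nn_integral_eq_integral[OF int_exp[of s]] unfolding subgaussian_def e_def
    by (metis (no_types, lifting) AE_I2 ennreal_le_iff exp_ge_zero)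
  \<comment> \<open>Chosen to make \<open>s\<^sup>2 * v\<close> equal to 1: the inequality becomes 2
    + Var / v \<le> 2 e, and e \<le> 3 yields the constant 4.\<close>
  define s where "s = 1 / sqrt v"
  have s2: "s\<^sup>2 = 1 / v" using v by (simp add: s_def power_divide)
  have "2 + s\<^sup>2 * (\<integral>x. (f x - e)\<^sup>2 \<partial>M) = (\<integral>x. 2 + s\<^sup>2 * (f x - e)\<^sup>2 \<partial>M)"
    using int_sq by (simp add: M.prob_space)
  also have "\<dots> \<le> (\<integral>x. exp (s * (f x - e)) + exp ((- s) * (f x - e)) \<partial>M)"
    using int_sq int_exp[of s] int_exp[of "- s"] exp_add_exp_minus_ge[of "s * (f _ - e)"]
    by (intro integral_mono) (auto simp: power_mult_distrib)
  also have "\<dots> \<le> 2 * exp 1"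
    using le[of s] le[of "- s"] int_exp[of s] int_exp[of "- s"] v by (simp add: s2)
  also have "\<dots> \<le> 2 * 3" using exp_le by simp
  finally show ?thesis using v unfolding s2 e_def by (simp add: field_simps)
qed

subsection \<open>Haar measures on the stabilizers\<close>

lemma space_unitary_space [simp]: "space (unitary_space n) = unitary_set n"
  unfolding unitary_space_def by (rule space_measure_of) auto

lemma measurable_entry [measurable]:
  assumes "i < n" "j < n"
  shows "(\<lambda>U. U $$ (i, j)) \<in> borel_measurable (unitary_space n)"
proof (rule measurableI)
  fix S :: "complex set" assume S: "S \<in> sets borel"
  let ?G = "{(\<lambda>U. U $$ (i, j)) -` S \<inter> unitary_set n | i j S. i < n \<and> j < n \<and> S \<in> sets borel}"
  have "(\<lambda>U. U $$ (i, j)) -` S \<inter> unitary_set n \<in> ?G"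
    unfolding mem_Collect_eq
    by (rule exI[of _ i], rule exI[of _ j], rule exI[of _ S]) (simp add: assms S)
  moreover have "?G \<subseteq> Pow (unitary_set n)" by auto
  ultimately show "(\<lambda>U. U $$ (i, j)) -` S \<inter> space (unitary_space n) \<in> sets (unitary_space n)"
    unfolding space_unitary_space unfolding unitary_space_def by (intro in_measure_of)
qed simp

lemma measurable_unitary_spaceI:
  assumes "\<And>x. x \<in> space M \<Longrightarrow> g x \<in> unitary_set n"
    and "\<And>i j. i < n \<Longrightarrow> j < n \<Longrightarrow> (\<lambda>x. g x $$ (i, j)) \<in> borel_measurable M"
  shows "g \<in> measurable M (unitary_space n)"
  unfolding unitary_space_def
proof (rule measurable_measure_of)
  fix y assume "y \<in> {(\<lambda>U. U $$ (i, j)) -` S \<inter> unitary_set n |i j S. i < n \<and> j < n \<and> S \<in> sets borel}"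
  then obtain i j S where y: "y = (\<lambda>U. U $$ (i, j)) -` S \<inter> unitary_set n" "i < n" "j < n" "S \<in> sets borel"
    by blast
  have "g -` y \<inter> space M = (\<lambda>x. g x $$ (i, j)) -` S \<inter> space M"
    unfolding y(1) using assms(1) by auto
  also have "\<dots> \<in> sets M"
    using assms(2)[OF y(2,3)] y(4) by (rule measurable_sets)
  finally show "g -` y \<inter> space M \<in> sets M" .
qed (use assms(1) in auto)

lemma measurable_mult_entry:
  fixes F G :: "'a \<Rightarrow> complex mat"
  assumes "\<And>x. x \<in> space M \<Longrightarrow> F x \<in> carrier_mat n m" "\<And>x. x \<in> space M \<Longrightarrow> G x \<in> carrier_mat m p"
    and "\<And>i j. i < n \<Longrightarrow> j < m \<Longrightarrow> (\<lambda>x. F x $$ (i, j)) \<in> borel_measurable M"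
    and "\<And>i j. i < m \<Longrightarrow> j < p \<Longrightarrow> (\<lambda>x. G x $$ (i, j)) \<in> borel_measurable M"
    and "i < n" "j < p"
  shows "(\<lambda>x. (F x * G x) $$ (i, j)) \<in> borel_measurable M"
proof -
  have "(\<lambda>x. (F x * G x) $$ (i, j)) \<in> borel_measurable M \<longleftrightarrow>
      (\<lambda>x. \<Sum>k<m. F x $$ (i, k) * G x $$ (k, j)) \<in> borel_measurable M"
    using assms by (intro measurable_cong) (rule index_mult_mat_sum)
  also have "\<dots>" using assms by (intro borel_measurable_sum borel_measurable_times) auto
  finally show ?thesis .
qed

lemma measurable_adjoint_entry:
  fixes F :: "'a \<Rightarrow> complex mat"
  assumes "\<And>x. x \<in> space M \<Longrightarrow> F x \<in> carrier_mat n m"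
    and "\<And>i j. i < n \<Longrightarrow> j < m \<Longrightarrow> (\<lambda>x. F x $$ (i, j)) \<in> borel_measurable M"
    and "i < m" "j < n"
  shows "(\<lambda>x. mat_adjoint (F x) $$ (i, j)) \<in> borel_measurable M"
proof -
  have [measurable]: "cnj \<in> borel_measurable borel"
    by (intro borel_measurable_continuous_onI continuous_intros)
  have "(\<lambda>x. mat_adjoint (F x) $$ (i, j)) \<in> borel_measurable M \<longleftrightarrow>
      (\<lambda>x. cnj (F x $$ (j, i))) \<in> borel_measurable M"
  proof (rule measurable_cong)
    fix x assume "x \<in> space M"
    then show "mat_adjoint (F x) $$ (i, j) = cnj (F x $$ (j, i))"
      using assms(1)[of x] assms(3,4) by auto
  qed
  also have "\<dots>" using assms(2)[OF assms(4,3)] by measurable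
  finally show ?thesis .
qed

lemma measurable_unitary_entry:
  assumes "g \<in> measurable M (unitary_space n)" "i < n" "j < n"
  shows "(\<lambda>x. g x $$ (i, j)) \<in> borel_measurable M"
  using measurable_compose[OF assms(1) measurable_entry[OF assms(2,3)]] .

lemma measurable_unitary_carrier:
  assumes "g \<in> measurable M (unitary_space n)" "x \<in> space M"
  shows "g x \<in> unitary_set n"
  using measurable_space[OF assms] by simp

lemma measurable_unitary_mult [measurable (raw)]:
  assumes f: "f \<in> measurable M (unitary_space n)" and g: "g \<in> measurable M (unitary_space n)"
  shows "(\<lambda>x. f x * g x) \<in> measurable M (unitary_space n)"
proof (rule measurable_unitary_spaceI)
  fix x assume "x \<in> space M"
  then show "f x * g x \<in> unitary_set n"
    using f g by (intro unitary_set_mult measurable_unitary_carrier)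
next
  fix i j assume "i < n" "j < n"
  then show "(\<lambda>x. (f x * g x) $$ (i, j)) \<in> borel_measurable M"
    by (intro measurable_mult_entry[where n = n and m = n and p = n] measurable_unitary_entry[OF f]
        measurable_unitary_entry[OF g] unitary_setD(1) measurable_unitary_carrier[OF f] measurable_unitary_carrier[OF g])
qed

lemma measurable_unitary_adjoint [measurable (raw)]:
  assumes f: "f \<in> measurable M (unitary_space n)"
  shows "(\<lambda>x. mat_adjoint (f x)) \<in> measurable M (unitary_space n)"
proof (rule measurable_unitary_spaceI)
  fix x assume "x \<in> space M"
  then show "mat_adjoint (f x) \<in> unitary_set n"
    using f by (intro unitary_set_adjoint measurable_unitary_carrier)
next
  fix i j assume "i < n" "j < n"
  then show "(\<lambda>x. mat_adjoint (f x) $$ (i, j)) \<in> borel_measurable M"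
    by (intro measurable_adjoint_entry[where n = n and m = n] measurable_unitary_entry[OF f]
        unitary_setD(1) measurable_unitary_carrier[OF f])
qed

lemma measurable_unitary_const [measurable]:
  "W \<in> unitary_set n \<Longrightarrow> (\<lambda>_. W) \<in> measurable M (unitary_space n)"
  by (rule measurable_const) simp

text \<open>Written this way, the reflection is a rational expression in row \<open>j\<close> of
  \<open>U\<close> and its conjugates. Division with value 0 at the pole is Borel measurable, so the
  degenerate point \<open>U $$ (j, j) = 1\<close> is included.\<close>

lemma householder_row_entry:
  assumes U: "U \<in> unitary_set n" and ik: "i < n" "k < n" and j: "j < n"
  shows "householder n j (mat_adjoint U *\<^sub>v unit_vec n j) $$ (i, k) =
    (if i = k then 1 else 0) - 1 / (1 - U $$ (j, j)) *
      (((if i = j then 1 else 0) - cnj (U $$ (j, i))) * ((if k = j then 1 else 0) - U $$ (j, k)))"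
proof -
  have u: "U \<in> carrier_mat n n" by (rule unitary_setD(1)[OF U])
  have r: "(mat_adjoint U *\<^sub>v unit_vec n j) $ l = cnj (U $$ (j, l))" if "l < n" for l
    using u that j
    by (subst index_mult_mat_vec_sum[OF mat_adjoint_carrier[OF u] unit_vec_carrier that])
       (auto simp: if_distrib[of "\<lambda>x. _ * x"] cong: if_cong)
  show ?thesis
    using u ik j by (auto simp: householder_def Let_def r)
qed

lemma measurable_reflect [measurable]:
  assumes "j < n"
  shows "reflect n j \<in> measurable (unitary_space n) (unitary_space n)"
  unfolding reflect_def
proof (rule measurable_unitary_mult)
  show "(\<lambda>U. U) \<in> measurable (unitary_space n) (unitary_space n)" by simp
  show "(\<lambda>U. householder n j (mat_adjoint U *\<^sub>v unit_vec n j)) \<in> measurable (unitary_space n) (unitary_space n)"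
  proof (rule measurable_unitary_spaceI)
    fix U assume "U \<in> space (unitary_space n)"
    then have "U \<in> unitary_set n" by simp
    then show "householder n j (mat_adjoint U *\<^sub>v unit_vec n j) \<in> unitary_set n"
      by (intro householder_unitary adjoint_unit_vec assms)
  next
    fix i k assume ik: "i < n" "k < n"
    have [measurable]: "cnj \<in> borel_measurable borel"
      by (intro borel_measurable_continuous_onI continuous_intros)
    note [measurable] = measurable_entry[OF assms ik(1)] measurable_entry[OF assms ik(2)]
      measurable_entry[OF assms assms]
    have "(\<lambda>U. householder n j (mat_adjoint U *\<^sub>v unit_vec n j) $$ (i, k)) \<in> borel_measurable (unitary_space n) \<longleftrightarrow>
      (\<lambda>U. (if i = k then 1 else 0) - 1 / (1 - U $$ (j, j)) *
      (((if i = j then 1 else 0) - cnj (U $$ (j, i))) * ((if k = j then 1 else 0) - U $$ (j, k))))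
        \<in> borel_measurable (unitary_space n)"
      by (rule measurable_cong) (simp only: space_unitary_space householder_row_entry[OF _ ik assms])
    also have "\<dots>" by measurable
    finally show "(\<lambda>U. householder n j (mat_adjoint U *\<^sub>v unit_vec n j) $$ (i, k)) \<in> borel_measurable (unitary_space n)" .
  qed
qed

text \<open>The Haar measure of a subgroup is kept as a measure on the whole unitary group that is
  concentrated on \<open>K\<close>. One sigma-algebra then serves all stabilizers, and functions
  need not be restricted.\<close>

definition haar_on :: "nat \<Rightarrow> complex mat set \<Rightarrow> complex mat measure \<Rightarrow> bool" where
  "haar_on n K \<mu> \<longleftrightarrow> prob_space \<mu> \<and> sets \<mu> = sets (unitary_space n) \<and> (AE U in \<mu>. U \<in> K) \<and>
     (\<forall>W\<in>K. distr \<mu> (unitary_space n) (\<lambda>U. W * U) = \<mu>)"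

lemma is_haar_imp_haar_on: "is_haar n \<mu> \<Longrightarrow> haar_on n (unitary_set n) \<mu>"
  unfolding is_haar_def haar_on_def
  by (metis AE_I2 sets_eq_imp_space_eq space_unitary_space)

section \<open>Invariance properties of Haar measures on a subgroup\<close>

locale unitary_haar =
  fixes n :: nat and K :: "complex mat set" and \<mu> :: "complex mat measure"
  assumes K_unitary: "K \<subseteq> unitary_set n"
    and K_mult: "\<And>U V. U \<in> K \<Longrightarrow> V \<in> K \<Longrightarrow> U * V \<in> K"
    and K_adjoint: "\<And>U. U \<in> K \<Longrightarrow> mat_adjoint U \<in> K"
    and haar: "haar_on n K \<mu>"
begin

sublocale prob_space \<mu> using haar unfolding haar_on_def by blast

lemma sets_haar [measurable_cong, simp]: "sets \<mu> = sets (unitary_space n)"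
  using haar unfolding haar_on_def by blast

lemma space_haar [simp]: "space \<mu> = unitary_set n"
  using sets_eq_imp_space_eq[OF sets_haar] by simp

lemma emeasure_unitary_set [simp]: "emeasure \<mu> (unitary_set n) = 1"
  using emeasure_space_1 by simp

lemma prob_unitary_set [simp]: "prob (unitary_set n) = 1"
  using prob_space by simp

lemma AE_haar: "AE U in \<mu>. U \<in> K"
  using haar unfolding haar_on_def by blast

lemma nn_integral_mult_left:
  assumes W: "W \<in> K" and [measurable]: "f \<in> borel_measurable (unitary_space n)"
  shows "(\<integral>\<^sup>+U. f (W * U) \<partial>\<mu>) = (\<integral>\<^sup>+U. f U \<partial>\<mu>)"
proof -
  have [measurable]: "(\<lambda>_. W) \<in> measurable \<mu> (unitary_space n)" using W K_unitary by auto
  have "(\<integral>\<^sup>+U. f U \<partial>distr \<mu> (unitary_space n) (\<lambda>U. W * U)) = (\<integral>\<^sup>+U. f (W * U) \<partial>\<mu>)"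
    by (rule nn_integral_distr) measurable
  then show ?thesis using haar W unfolding haar_on_def by simp
qed

text \<open>Inversion invariance from left invariance alone: averaging
  \<open>f (mat_adjoint V * U)\<close> over \<open>U\<close> first gives the integral of
  \<open>f\<close>. Averaging over \<open>V\<close> first, after writing the argument as the adjoint
  of \<open>mat_adjoint U * V\<close>, gives the integral of \<open>f\<close> composed with the
  adjoint.\<close>

lemma nn_integral_adjoint:
  assumes [measurable]: "f \<in> borel_measurable (unitary_space n)"
  shows "(\<integral>\<^sup>+U. f (mat_adjoint U) \<partial>\<mu>) = (\<integral>\<^sup>+U. f U \<partial>\<mu>)"
proof -
  interpret P: pair_prob_space \<mu> \<mu> ..
  have "(\<integral>\<^sup>+U. f U \<partial>\<mu>) = (\<integral>\<^sup>+V. (\<integral>\<^sup>+U. f U \<partial>\<mu>) \<partial>\<mu>)"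
    by simp
  also have "\<dots> = (\<integral>\<^sup>+V. (\<integral>\<^sup>+U. f (mat_adjoint V * U) \<partial>\<mu>) \<partial>\<mu>)"
    by (rule nn_integral_cong_AE, use AE_haar in eventually_elim)
       (simp add: nn_integral_mult_left K_adjoint)
  also have "\<dots> = (\<integral>\<^sup>+U. (\<integral>\<^sup>+V. f (mat_adjoint V * U) \<partial>\<mu>) \<partial>\<mu>)"
    by (rule P.Fubini') measurable
  also have "\<dots> = (\<integral>\<^sup>+U. (\<integral>\<^sup>+V. f (mat_adjoint V) \<partial>\<mu>) \<partial>\<mu>)"
  proof (rule nn_integral_cong_AE, use AE_haar in eventually_elim)
    case (elim U)
    have U: "U \<in> unitary_set n" using elim K_unitary by auto
    have "(\<integral>\<^sup>+V. f (mat_adjoint V * U) \<partial>\<mu>) = (\<integral>\<^sup>+V. f (mat_adjoint (mat_adjoint U * V)) \<partial>\<mu>)"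
    proof (rule nn_integral_cong)
      fix V assume "V \<in> space \<mu>"
      then have "V \<in> carrier_mat n n" using unitary_setD(1) by simp
      then show "f (mat_adjoint V * U) = f (mat_adjoint (mat_adjoint U * V))"
        using mat_adjoint_mult[OF mat_adjoint_carrier[OF unitary_setD(1)[OF U]], of V n] by simp
    qed
    also have "\<dots> = (\<integral>\<^sup>+V. f (mat_adjoint V) \<partial>\<mu>)"
      by (rule nn_integral_mult_left[OF K_adjoint[OF elim], of "\<lambda>V. f (mat_adjoint V)"]) measurable
    finally show ?case .
  qed
  also have "\<dots> = (\<integral>\<^sup>+V. f (mat_adjoint V) \<partial>\<mu>)"
    by simp
  finally show ?thesis by simp
qed

text \<open>Right multiplication by \<open>W\<close> is left multiplication by
  \<open>mat_adjoint W\<close> between two adjoints.\<close>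

lemma nn_integral_mult_right:
  assumes W: "W \<in> K" and [measurable]: "f \<in> borel_measurable (unitary_space n)"
  shows "(\<integral>\<^sup>+U. f (U * W) \<partial>\<mu>) = (\<integral>\<^sup>+U. f U \<partial>\<mu>)"
proof -
  have w: "W \<in> unitary_set n" using W K_unitary by auto
  note [measurable] = measurable_unitary_const[OF w]
  have "(\<integral>\<^sup>+U. f (U * W) \<partial>\<mu>) = (\<integral>\<^sup>+U. f (mat_adjoint U * W) \<partial>\<mu>)"
    by (rule nn_integral_adjoint[of "\<lambda>U. f (U * W)", symmetric]) measurable
  also have "\<dots> = (\<integral>\<^sup>+U. f (mat_adjoint (mat_adjoint W * U)) \<partial>\<mu>)"
  proof (rule nn_integral_cong)
    fix V assume "V \<in> space \<mu>"
    then have "V \<in> carrier_mat n n" using unitary_setD(1) by simp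
    then show "f (mat_adjoint V * W) = f (mat_adjoint (mat_adjoint W * V))"
      using mat_adjoint_mult[OF mat_adjoint_carrier[OF unitary_setD(1)[OF w]], of V n] by simp
  qed
  also have "\<dots> = (\<integral>\<^sup>+U. f (mat_adjoint U) \<partial>\<mu>)"
    by (rule nn_integral_mult_left[OF K_adjoint[OF W], of "\<lambda>V. f (mat_adjoint V)"]) measurable
  also have "\<dots> = (\<integral>\<^sup>+U. f U \<partial>\<mu>)"
    by (rule nn_integral_adjoint) measurable
  finally show ?thesis .
qed

lemma distr_mult_right:
  assumes W: "W \<in> K"
  shows "distr \<mu> (unitary_space n) (\<lambda>U. U * W) = \<mu>"
proof (rule measure_eqI)
  have w: "W \<in> unitary_set n" using W K_unitary by auto
  note [measurable] = measurable_unitary_const[OF w]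
  fix A assume "A \<in> sets (distr \<mu> (unitary_space n) (\<lambda>U. U * W))"
  then have A [measurable]: "A \<in> sets (unitary_space n)" by simp
  have "emeasure (distr \<mu> (unitary_space n) (\<lambda>U. U * W)) A =
      (\<integral>\<^sup>+U. indicator A U \<partial>distr \<mu> (unitary_space n) (\<lambda>U. U * W))"
    by (rule nn_integral_indicator[symmetric]) simp
  also have "\<dots> = (\<integral>\<^sup>+U. indicator A (U * W) \<partial>\<mu>)"
    by (rule nn_integral_distr) measurable
  also have "\<dots> = (\<integral>\<^sup>+U. indicator A U \<partial>\<mu>)"
    by (rule nn_integral_mult_right[OF W]) measurable
  also have "\<dots> = emeasure \<mu> A"
    by (rule nn_integral_indicator) simp
  finally show "emeasure (distr \<mu> (unitary_space n) (\<lambda>U. U * W)) A = emeasure \<mu> A" .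
qed simp

lemma integral_mult_right:
  fixes f :: "complex mat \<Rightarrow> real"
  assumes W: "W \<in> K" and [measurable]: "f \<in> borel_measurable (unitary_space n)"
  shows "(\<integral>U. f (U * W) \<partial>\<mu>) = (\<integral>U. f U \<partial>\<mu>)"
proof -
  have w: "W \<in> unitary_set n" using W K_unitary by auto
  note [measurable] = measurable_unitary_const[OF w]
  have "(\<integral>U. f U \<partial>distr \<mu> (unitary_space n) (\<lambda>U. U * W)) = (\<integral>U. f (U * W) \<partial>\<mu>)"
    by (rule integral_distr) measurable
  then show ?thesis using distr_mult_right[OF W] by simp
qed

lemma integral_mult_left:
  fixes f :: "complex mat \<Rightarrow> real"
  assumes W: "W \<in> K" and [measurable]: "f \<in> borel_measurable (unitary_space n)"
  shows "(\<integral>U. f (W * U) \<partial>\<mu>) = (\<integral>U. f U \<partial>\<mu>)"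
proof -
  have w: "W \<in> unitary_set n" using W K_unitary by auto
  note [measurable] = measurable_unitary_const[OF w]
  have "(\<integral>U. f U \<partial>distr \<mu> (unitary_space n) (\<lambda>U. W * U)) = (\<integral>U. f (W * U) \<partial>\<mu>)"
    by (rule integral_distr) measurable
  then show ?thesis using haar W unfolding haar_on_def by simp
qed

end

section \<open>Haar measures along the stabilizer chain\<close>

lemma unitary_haar_stab: "haar_on n (stab n j) \<mu> \<Longrightarrow> unitary_haar n (stab n j) \<mu>"
  by unfold_locales (auto intro: stab_unitary stab_mult stab_adjoint)

text \<open>Finitely many entry conditions describe the stabilizer. Measurability is needed to
  transport concentration on it through the image measure.\<close>

lemma stab_measurable:
  assumes "j \<le> n"
  shows "stab n j \<in> sets (unitary_space n)"
proof -
  have "stab n j = {U \<in> space (unitary_space n). \<forall>k\<in>{..<j}. \<forall>i\<in>{..<n}. U $$ (i, k) = unit_vec n k $ i}"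
    (is "_ = ?S")
  proof (intro equalityI subsetI)
    have entry: "(U *\<^sub>v unit_vec n k) $ i = U $$ (i, k)"
      if "U \<in> unitary_set n" "k < n" "i < n" for U i k
      using that by (subst index_mult_mat_vec_sum[OF unitary_setD(1)[OF that(1)] unit_vec_carrier that(3)])
        (auto simp: if_distrib[of "\<lambda>x. _ * x"] cong: if_cong)
    show "U \<in> ?S" if U: "U \<in> stab n j" for U
    proof -
      have "U $$ (i, k) = unit_vec n k $ i" if "k < j" "i < n" for k i
        using entry[OF stab_unitary[OF U], of k i] U that assms by (simp add: stab_def)
      then show ?thesis using stab_unitary[OF U] by simp
    qed
    show "U \<in> stab n j" if U: "U \<in> ?S" for U
    proof -
      have u: "U \<in> unitary_set n" using U by simp
      have "U *\<^sub>v unit_vec n k = unit_vec n k" if "k < j" for k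
      proof (rule eq_vecI)
        show "(U *\<^sub>v unit_vec n k) $ i = unit_vec n k $ i" if "i < dim_vec (unit_vec n k)" for i
          using entry[OF u, of k i] U that \<open>k < j\<close> assms by simp
      qed (use unitary_setD(1)[OF u] in simp)
      then show ?thesis using u by (simp add: stab_def)
    qed
  qed
  also have "\<dots> \<in> sets (unitary_space n)"
  proof (intro sets.sets_Collect_finite_All)
    fix k i assume "k \<in> {..<j}" "i \<in> {..<n}"
    then have [measurable]: "(\<lambda>U. U $$ (i, k)) \<in> borel_measurable (unitary_space n)"
      using assms by (intro measurable_entry) auto
    show "{U \<in> space (unitary_space n). U $$ (i, k) = unit_vec n k $ i} \<in> sets (unitary_space n)"
      by measurable
  qed auto
  finally show ?thesis .
qed

text \<open>For \<open>W\<close> in the smaller stabilizer, \<open>W * reflect n j U\<close> is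
  \<open>reflect n j (W * U)\<close>, and left invariance of \<mu> applies to \<open>W\<close>
  because the smaller stabilizer lies in the larger one. So the Haar measures of the whole chain are
  images of the given one.\<close>

lemma haar_on_stab_Suc:
  assumes \<mu>: "haar_on n (stab n j) \<mu>" and j: "j < n"
  shows "haar_on n (stab n (Suc j)) (distr \<mu> (unitary_space n) (reflect n j))"
proof -
  interpret unitary_haar n "stab n j" \<mu> by (rule unitary_haar_stab[OF \<mu>])
  note [measurable] = measurable_reflect[OF j]
  let ?\<nu> = "distr \<mu> (unitary_space n) (reflect n j)"
  have "prob_space ?\<nu>" by (rule prob_space_distr) measurable
  moreover have "AE U in ?\<nu>. U \<in> stab n (Suc j)"
  proof (subst AE_distr_iff)
    show "reflect n j \<in> measurable \<mu> (unitary_space n)" by measurable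
    have "{U \<in> space (unitary_space n). U \<in> stab n (Suc j)} = stab n (Suc j)"
      using stab_unitary by auto
    then show "{U \<in> space (unitary_space n). U \<in> stab n (Suc j)} \<in> sets (unitary_space n)"
      using stab_measurable[of "Suc j" n] j by simp
    show "AE U in \<mu>. reflect n j U \<in> stab n (Suc j)"
      using AE_haar by eventually_elim (rule reflect_stab[OF _ j])
  qed
  moreover have "distr ?\<nu> (unitary_space n) (\<lambda>U. W * U) = ?\<nu>" if W: "W \<in> stab n (Suc j)" for W
  proof -
    have w: "W \<in> unitary_set n" using W stab_unitary by blast
    note [measurable] = measurable_unitary_const[OF w]
    have "distr ?\<nu> (unitary_space n) (\<lambda>U. W * U) = distr \<mu> (unitary_space n) (\<lambda>U. W * reflect n j U)"
      by (subst distr_distr) (measurable, simp add: o_def)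
    also have "\<dots> = distr \<mu> (unitary_space n) (\<lambda>U. reflect n j (W * U))"
      by (rule distr_cong) (simp_all add: reflect_mult[OF W])
    also have "\<dots> = distr (distr \<mu> (unitary_space n) (\<lambda>U. W * U)) (unitary_space n) (reflect n j)"
      by (subst distr_distr) (measurable, simp add: o_def)
    also have "distr \<mu> (unitary_space n) (\<lambda>U. W * U) = \<mu>"
      using \<mu> stab_mono[OF W] unfolding haar_on_def by blast
    finally show ?thesis .
  qed
  ultimately show ?thesis unfolding haar_on_def by simp
qed

lemma one_in_stab: "1\<^sub>m n \<in> stab n j"
  by (auto simp: stab_def)

text \<open>Conditioning on the coset of the smaller stabilizer is replaced by multiplying with an
  independent Haar element \<open>W\<close> of that stabilizer, which does not change the law.\<close>

lemma subgaussian_haar_stab: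
  assumes "haar_on n (stab n j) \<mu>" "j \<le> n" and f: "f \<in> borel_measurable (unitary_space n)"
    and B: "\<And>U. U \<in> unitary_set n \<Longrightarrow> \<bar>f U\<bar> \<le> B"
    and lip: "\<And>U U'. U \<in> unitary_set n \<Longrightarrow> U' \<in> unitary_set n \<Longrightarrow> nearby n U U' \<Longrightarrow> \<bar>f U - f U'\<bar> \<le> c"
  shows "subgaussian \<mu> f (real (n - j) * (c\<^sup>2 / 8))"
  using assms
proof (induction "n - j" arbitrary: j \<mu> f)
  case 0
  interpret unitary_haar n "stab n j" \<mu> by (rule unitary_haar_stab[OF 0(2)])
  note [measurable] = 0(4)
  \<comment> \<open>At the bottom of the chain the measure sits on the identity, so \<open>f\<close>
    is almost surely constant.\<close>
  have "AE U in \<mu>. U \<in> stab n n" using AE_haar 0(1,3) by simp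
  then have "AE U in \<mu>. f U = f (1\<^sub>m n)"
    by eventually_elim (use stab_full in auto)
  then have "subgaussian \<mu> f 0"
    by (intro subgaussian_of_AE_const) (unfold_locales, measurable)
  then show ?case using 0(1) by simp
next
  case (Suc k)
  then have j: "j < n" by simp
  note B = Suc.prems(4) and lip = Suc.prems(5)
  interpret unitary_haar n "stab n j" \<mu> by (rule unitary_haar_stab[OF Suc.prems(1)])
  note [measurable] = Suc.prems(3)
  define \<nu> where "\<nu> = distr \<mu> (unitary_space n) (reflect n j)"
  have \<nu>h: "haar_on n (stab n (Suc j)) \<nu>" unfolding \<nu>_def by (rule haar_on_stab_Suc[OF Suc.prems(1) j])
  interpret N: unitary_haar n "stab n (Suc j)" \<nu> by (rule unitary_haar_stab[OF \<nu>h])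
  interpret P: pair_prob_space \<mu> \<nu> ..
  note [measurable] = measurable_fst[of \<mu> \<nu>] measurable_snd[of \<mu> \<nu>]
  \<comment> \<open>\<open>U\<close> represents a coset and \<open>W\<close> moves within it. The
    induction hypothesis controls each fibre, as \<open>nearby\<close> survives right multiplication
    by \<open>U\<close>; one Hoeffding step controls the fibre mean.\<close>
  define F where "F = (\<lambda>(U, W). f (W * U))"
  have F [measurable]: "F \<in> borel_measurable (\<mu> \<Otimes>\<^sub>M \<nu>)" unfolding F_def by measurable
  have space_P: "space (\<mu> \<Otimes>\<^sub>M \<nu>) = unitary_set n \<times> unitary_set n"
    by (simp add: space_pair_measure)
  have FB: "\<bar>F z\<bar> \<le> B" if "z \<in> space (\<mu> \<Otimes>\<^sub>M \<nu>)" for z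
    using that B unitary_set_mult unfolding space_P F_def by auto
  have fibre: "subgaussian \<nu> (\<lambda>W. F (U, W)) (real k * (c\<^sup>2 / 8))" if U: "U \<in> unitary_set n" for U
  proof -
    note [measurable] = measurable_unitary_const[OF U]
    have "subgaussian \<nu> (\<lambda>W. f (W * U)) (real (n - Suc j) * (c\<^sup>2 / 8))"
    proof (rule Suc.hyps(1)[OF _ \<nu>h])
      show "k = n - Suc j" using Suc.hyps(2) by simp
      show "Suc j \<le> n" using j by simp
      show "(\<lambda>W. f (W * U)) \<in> borel_measurable (unitary_space n)" by measurable
      show "\<bar>f (W * U)\<bar> \<le> B" if "W \<in> unitary_set n" for W
        by (rule B[OF unitary_set_mult[OF that U]])
      show "\<bar>f (W * U) - f (W' * U)\<bar> \<le> c"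
        if W: "W \<in> unitary_set n" "W' \<in> unitary_set n" "nearby n W W'" for W W'
        by (rule lip[OF unitary_set_mult[OF W(1) U] unitary_set_mult[OF W(2) U]
            nearby_mult_right[OF W(3) unitary_setD(1)[OF W(1)] unitary_setD(1)[OF W(2)] unitary_setD(1)[OF U]]])
    qed
    moreover have "n - Suc j = k" using Suc.hyps(2) by simp
    ultimately show ?thesis by (simp add: F_def)
  qed
  define m where "m U = (\<integral>W. F (U, W) \<partial>\<nu>)" for U
  have m_meas [measurable]: "m \<in> borel_measurable \<mu>" unfolding m_def by measurable
  have int: "integrable \<nu> (\<lambda>W. f (W * U))" if U: "U \<in> unitary_set n" for U
  proof (rule N.integrable_const_bound[where B = B])
    note [measurable] = measurable_unitary_const[OF U]
    show "(\<lambda>W. f (W * U)) \<in> borel_measurable \<nu>" by measurable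
    show "AE W in \<nu>. norm (f (W * U)) \<le> B"
      by (rule AE_I2) (simp add: B unitary_set_mult[OF _ U])
  qed
  \<comment> \<open>The coset average \<open>m\<close> is independent of the representative, as
    right invariance of \<nu> absorbs \<open>W0\<close>. So \<open>U'\<close> may be replaced by the
    point \<open>W0 * U'\<close> of its coset that is close to \<open>U\<close>, and a common left
    factor \<open>W\<close> keeps the two points close.\<close>
  have m_diff: "m U \<le> m U' + c" if U: "U \<in> stab n j" "U' \<in> stab n j" for U U'
  proof -
    obtain W0 where W0: "W0 \<in> stab n (Suc j)" "nearby n U (W0 * U')"
      by (rule stab_coset_nearby[OF U j])
    have u: "U \<in> unitary_set n" "U' \<in> unitary_set n" "W0 \<in> unitary_set n" "W0 * U' \<in> unitary_set n"
      using U W0 stab_unitary unitary_set_mult by blast+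
    note [measurable] = measurable_unitary_const[OF u(2)]
    have "m U' = (\<integral>W. f ((W * W0) * U') \<partial>\<nu>)"
      unfolding m_def F_def split_conv
      by (rule N.integral_mult_right[OF W0(1), of "\<lambda>W. f (W * U')", symmetric]) measurable
    also have "\<dots> = (\<integral>W. f (W * (W0 * U')) \<partial>\<nu>)"
    proof (rule Bochner_Integration.integral_cong[OF refl])
      fix W assume "W \<in> space \<nu>"
      then have "W \<in> carrier_mat n n" using unitary_setD(1) by simp
      then show "f ((W * W0) * U') = f (W * (W0 * U'))"
        using assoc_mult_mat[of W n n W0 n U' n] unitary_setD(1)[OF u(2)] unitary_setD(1)[OF u(3)] by simp
    qed
    finally have mU': "m U' = (\<integral>W. f (W * (W0 * U')) \<partial>\<nu>)" .
    have "m U = (\<integral>W. f (W * U) \<partial>\<nu>)" by (simp add: m_def F_def)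
    also have "\<dots> \<le> (\<integral>W. f (W * (W0 * U')) + c \<partial>\<nu>)"
    proof (rule integral_mono)
      show "integrable \<nu> (\<lambda>W. f (W * U))" by (rule int[OF u(1)])
      show "integrable \<nu> (\<lambda>W. f (W * (W0 * U')) + c)" using int[OF u(4)] by simp
      fix W assume "W \<in> space \<nu>"
      then have W: "W \<in> unitary_set n" by simp
      have "nearby n (W * U) (W * (W0 * U'))"
        by (rule nearby_mult_left[OF W0(2)]) (intro unitary_setD(1) u W)+
      then have "\<bar>f (W * U) - f (W * (W0 * U'))\<bar> \<le> c"
        by (intro lip unitary_set_mult[OF W] u)
      then show "f (W * U) \<le> f (W * (W0 * U')) + c" by simp
    qed
    also have "\<dots> = m U' + c"
      using int[OF u(4)] by (simp add: mU')
    finally show ?thesis .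
  qed
  have mean: "subgaussian \<mu> m (c\<^sup>2 / 8)"
  proof (rule subgaussian_of_bounded)
    show "prob_space \<mu>" by unfold_locales
    show "m \<in> borel_measurable \<mu>" by measurable
    \<comment> \<open>The infimum runs over the stabilizer only: the oscillation bound was shown
      there, and \<mu> is concentrated on it.\<close>
    let ?a = "Inf (m ` stab n j)"
    have bdd: "bdd_below (m ` stab n j)"
      by (rule bdd_belowI2[of _ "m (1\<^sub>m n) - c"]) (use m_diff[OF one_in_stab] in \<open>simp add: algebra_simps\<close>)
    show "AE U in \<mu>. m U \<in> {?a..?a + c}"
      using AE_haar
    proof eventually_elim
      case (elim U)
      have "?a \<le> m U" by (rule cInf_lower[OF _ bdd]) (use elim in simp)
      moreover have "m U - c \<le> ?a"
        by (rule cInf_greatest) (use elim m_diff[OF elim] in \<open>auto simp: algebra_simps\<close>)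
      ultimately show ?case by simp
    qed
  qed
  have sub: "subgaussian (\<mu> \<Otimes>\<^sub>M \<nu>) F (real k * (c\<^sup>2 / 8) + c\<^sup>2 / 8)"
  proof (rule subgaussian_fibres[OF _ _ F FB])
    show "prob_space \<mu>" "prob_space \<nu>" by unfold_locales
    show "AE U in \<mu>. subgaussian \<nu> (\<lambda>W. F (U, W)) (real k * (c\<^sup>2 / 8))"
      by (intro AE_I2 fibre) simp
    show "subgaussian \<mu> (\<lambda>U. \<integral>W. F (U, W) \<partial>\<nu>) (c\<^sup>2 / 8)" using mean unfolding m_def .
  qed
  \<comment> \<open>For the return from \<open>F\<close> to \<open>f\<close>, integration over
    \<open>U\<close> is done first: for fixed \<open>W\<close>, left invariance of \<mu> turns
    \<open>W * U\<close> into \<open>U\<close>.\<close>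
  have invariant: "AE W in \<nu>. W \<in> stab n j" using N.AE_haar by eventually_elim (rule stab_mono)
  have "(\<integral>z. F z \<partial>(\<mu> \<Otimes>\<^sub>M \<nu>)) = (\<integral>W. (\<integral>U. f (W * U) \<partial>\<mu>) \<partial>\<nu>)"
  proof -
    have "integrable (\<mu> \<Otimes>\<^sub>M \<nu>) (case_prod (\<lambda>U W. f (W * U)))"
      using F FB unfolding F_def by (intro P.P.integrable_const_bound[where B = B]) auto
    from P.integral_snd[OF this] show ?thesis by (simp add: F_def)
  qed
  also have "\<dots> = (\<integral>W. (\<integral>U. f U \<partial>\<mu>) \<partial>\<nu>)"
  proof (rule integral_cong_AE)
    show "(\<lambda>W. \<integral>U. f (W * U) \<partial>\<mu>) \<in> borel_measurable \<nu>" by measurable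
    show "AE W in \<nu>. (\<integral>U. f (W * U) \<partial>\<mu>) = (\<integral>U. f U \<partial>\<mu>)"
      using invariant by eventually_elim (rule integral_mult_left[OF _ Suc.prems(3)])
  qed simp
  finally have mean_eq: "(\<integral>z. F z \<partial>(\<mu> \<Otimes>\<^sub>M \<nu>)) = (\<integral>U. f U \<partial>\<mu>)" by simp
  have "(\<integral>\<^sup>+U. ennreal (exp (s * (f U - e))) \<partial>\<mu>) = (\<integral>\<^sup>+z. ennreal (exp (s * (F z - e))) \<partial>(\<mu> \<Otimes>\<^sub>M \<nu>))" for s e
  proof -
    have "(\<integral>\<^sup>+z. ennreal (exp (s * (F z - e))) \<partial>(\<mu> \<Otimes>\<^sub>M \<nu>)) =
        (\<integral>\<^sup>+W. \<integral>\<^sup>+U. ennreal (exp (s * (F (U, W) - e))) \<partial>\<mu> \<partial>\<nu>)"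
      by (rule P.nn_integral_snd[symmetric]) measurable
    also have "\<dots> = (\<integral>\<^sup>+W. \<integral>\<^sup>+U. ennreal (exp (s * (f U - e))) \<partial>\<mu> \<partial>\<nu>)"
      unfolding F_def split_conv
      by (rule nn_integral_cong_AE, use invariant in eventually_elim)
         (rule nn_integral_mult_left[of _ "\<lambda>U. ennreal (exp (s * (f U - e)))"], auto)
    also have "\<dots> = (\<integral>\<^sup>+U. ennreal (exp (s * (f U - e))) \<partial>\<mu>)" by simp
    finally show ?thesis by simp
  qed
  then have "subgaussian \<mu> f (real k * (c\<^sup>2 / 8) + c\<^sup>2 / 8)"
    using sub unfolding subgaussian_def mean_eq by simp
  moreover have "real k * (c\<^sup>2 / 8) + c\<^sup>2 / 8 = real (n - j) * (c\<^sup>2 / 8)"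
    unfolding Suc.hyps(2)[symmetric] by (simp add: algebra_simps)
  ultimately show ?case by (simp only:)
qed

subsection \<open>Concentration of the empirical distribution function\<close>

lemma indicator_atMost_polynomial_limit:
  fixes x :: real
  obtains a :: "nat \<Rightarrow> nat \<Rightarrow> real" and N :: "nat \<Rightarrow> nat"
  where "\<And>y. (\<lambda>m. \<Sum>i\<le>N m. a m i * y ^ i) \<longlonglongrightarrow> (if y \<le> x then 1 else 0)"
proof -
  \<comment> \<open>For positive \<open>m\<close> this ramp is 1 up to \<open>x\<close> and falls to
    0 between \<open>x\<close> and x + 1/m. The slope lies to the right of \<open>x\<close>, so the
    limit at \<open>x\<close> itself is 1, as the closed half-line requires.\<close>
  define g where "g m y = max 0 (min 1 (1 - real m * (y - x)))" for m y
  \<comment> \<open>Weierstrass approximation works on compact intervals. They grow with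
    \<open>m\<close> so that each \<open>y\<close> is eventually covered, while the error tends to
    0.\<close>
  have "\<exists>a N. \<forall>y\<in>{- real m..real m}. \<bar>g m y - (\<Sum>i\<le>N. a i * y ^ i)\<bar> < 1 / real (Suc m)" for m
  proof -
    have "continuous_on {- real m..real m} (g m)"
      unfolding g_def by (intro continuous_intros)
    then obtain p where p: "real_polynomial_function p"
      "\<And>y. y \<in> {- real m..real m} \<Longrightarrow> \<bar>g m y - p y\<bar> < 1 / real (Suc m)"
      using Stone_Weierstrass_real_polynomial_function[of "{- real m..real m}" "g m" "1 / real (Suc m)"]
      by (metis compact_Icc of_nat_0_less_iff zero_less_Suc zero_less_divide_1_iff)
    obtain a :: "nat \<Rightarrow> real" and N where "p = (\<lambda>y. \<Sum>i\<le>N. a i * y ^ i)"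
      using p(1) unfolding real_polynomial_function_iff_sum by blast
    then show ?thesis using p(2) by blast
  qed
  then obtain a N where aN: "\<And>m y. y \<in> {- real m..real m} \<Longrightarrow>
      \<bar>g m y - (\<Sum>i\<le>N m. a m i * y ^ i)\<bar> < 1 / real (Suc m)"
    by metis
  have "(\<lambda>m. \<Sum>i\<le>N m. a m i * y ^ i) \<longlonglongrightarrow> (if y \<le> x then 1 else 0)" for y
  proof -
    obtain m0 where m0: "\<bar>y\<bar> \<le> real m0" using real_arch_simple by blast
    have "(\<lambda>m. 1 / real (Suc m)) \<longlonglongrightarrow> 0"
      using LIMSEQ_inverse_real_of_nat by (simp add: inverse_eq_divide)
    moreover have "eventually (\<lambda>m. norm (g m y - (\<Sum>i\<le>N m. a m i * y ^ i)) \<le> 1 / real (Suc m)) sequentially"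
      using eventually_ge_at_top[of m0]
    proof eventually_elim
      case (elim m)
      then have "y \<in> {- real m..real m}" using m0 by (auto simp: abs_le_iff)
      then show ?case using aN[of y m] by simp
    qed
    ultimately have diff: "(\<lambda>m. g m y - (\<Sum>i\<le>N m. a m i * y ^ i)) \<longlonglongrightarrow> 0"
      by (rule tendsto_0_le[where K = 1, OF _ eventually_mono]) simp
    have "eventually (\<lambda>m. g m y = (if y \<le> x then 1 else 0)) sequentially"
    proof (cases "y \<le> x")
      case True
      then have "real m * (y - x) \<le> 0" for m by (simp add: mult_nonneg_nonpos)
      then have "g m y = 1" for m unfolding g_def by (smt (verit))
      then show ?thesis using True by simp
    next
      case False
      obtain m1 where m1: "1 / (y - x) \<le> real m1" using real_arch_simple by blast
      show ?thesis using eventually_ge_at_top[of m1]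
      proof eventually_elim
        case (elim m)
        then have "1 / (y - x) \<le> real m" using m1 by linarith
        then have "1 \<le> real m * (y - x)" using False by (simp add: divide_le_eq)
        then show ?case using False by (simp add: g_def)
      qed
    qed
    then have "(\<lambda>m. g m y) \<longlonglongrightarrow> (if y \<le> x then 1 else 0)"
      by (rule tendsto_eventually)
    from tendsto_diff[OF this diff] show ?thesis by simp
  qed
  then show ?thesis using that by blast
qed

lemma measurable_pow_mat_entry:
  fixes H :: "'a \<Rightarrow> complex mat"
  assumes H: "\<And>z. z \<in> space M \<Longrightarrow> H z \<in> carrier_mat n n"
    and meas: "\<And>i j. i < n \<Longrightarrow> j < n \<Longrightarrow> (\<lambda>z. H z $$ (i, j)) \<in> borel_measurable M"
    and ij: "i < n" "j < n"
  shows "(\<lambda>z. (H z ^\<^sub>m k) $$ (i, j)) \<in> borel_measurable M"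
  using ij
proof (induction k arbitrary: i j)
  case 0
  have "(\<lambda>z. (H z ^\<^sub>m 0) $$ (i, j)) \<in> borel_measurable M \<longleftrightarrow>
      (\<lambda>z. if i = j then 1 else 0 :: complex) \<in> borel_measurable M"
  proof (rule measurable_cong)
    fix z assume "z \<in> space M"
    then show "(H z ^\<^sub>m 0) $$ (i, j) = (if i = j then 1 else 0)" using H[of z] 0 by auto
  qed
  then show ?case by simp
next
  case (Suc k)
  show ?case
    unfolding pow_mat.simps
    by (rule measurable_mult_entry[where n = n and m = n and p = n])
       (use H meas Suc in \<open>auto intro: pow_carrier_mat\<close>)
qed

text \<open>The number of eigenvalues below \<open>x\<close> is a pointwise limit of traces of polynomials in the matrix.\<close>

lemma measurable_esd_cdf:
  fixes H :: "'a \<Rightarrow> complex mat"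
  assumes H: "\<And>z. z \<in> space M \<Longrightarrow> hermitian_mat n (H z)"
    and meas: "\<And>i j. i < n \<Longrightarrow> j < n \<Longrightarrow> (\<lambda>z. H z $$ (i, j)) \<in> borel_measurable M"
  shows "(\<lambda>z. esd_cdf (H z) x) \<in> borel_measurable M"
proof -
  obtain a N where lim: "\<And>y. (\<lambda>m. \<Sum>i\<le>N m. a m i * y ^ i) \<longlonglongrightarrow> (if y \<le> x then 1 else 0 :: real)"
    using indicator_atMost_polynomial_limit by blast
  have carrier: "H z \<in> carrier_mat n n" if "z \<in> space M" for z
    using H[OF that] by (simp add: hermitian_mat_def)
  define u where "u m z = (\<Sum>i\<le>N m. a m i * Re (\<Sum>l<n. (H z ^\<^sub>m i) $$ (l, l))) / real n" for m z
  show ?thesis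
  proof (rule borel_measurable_LIMSEQ_real)
    show "u m \<in> borel_measurable M" for m
      unfolding u_def
      by (intro borel_measurable_divide borel_measurable_sum borel_measurable_times borel_measurable_const
          measurable_compose[OF _ borel_measurable_Re] measurable_pow_mat_entry[OF carrier meas]) auto
    fix z assume z: "z \<in> space M"
    \<comment> \<open>The diagonalization is taken at the single point \<open>z\<close> and serves
      only to identify the pointwise limit.\<close>
    obtain U d where Ud: "U \<in> unitary_set n" "mat_adjoint U * H z * U = real_diag_mat n d"
      by (rule hermitian_diagonalization[OF H[OF z]])
    have "u m z = (\<Sum>l<n. \<Sum>i\<le>N m. a m i * d l ^ i) / real n" for m
      unfolding u_def trace_power_diagonalized[OF carrier[OF z] Ud]
      by (subst sum.swap) (simp add: sum_distrib_left)
    moreover have "(\<lambda>m. (\<Sum>l<n. \<Sum>i\<le>N m. a m i * d l ^ i) / real n) \<longlonglongrightarrow>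
        (\<Sum>l<n. if d l \<le> x then 1 else 0) / real n"
      unfolding divide_inverse by (intro tendsto_mult_right tendsto_sum lim)
    moreover have "(\<Sum>l<n. if d l \<le> x then 1 else 0 :: real) = real (card {l. l < n \<and> d l \<le> x})"
      by (simp add: sum.If_cases Collect_conj_eq lessThan_def)
    ultimately show "(\<lambda>m. u m z) \<longlonglongrightarrow> esd_cdf (H z) x"
      unfolding esd_cdf_diagonalized[OF carrier[OF z] Ud] by simp
  qed
qed

section \<open>Concentration for the sum of two independent rotations\<close>

lemma subgaussian_esd_cdf_sum:
  fixes M N :: "complex mat" and x :: real
  assumes n: "n > 0" and M: "hermitian_mat n M" and N: "hermitian_mat n N" and \<mu>: "is_haar n \<mu>"
  defines "F \<equiv> \<lambda>(U, V). esd_cdf (U * M * mat_adjoint U + V * N * mat_adjoint V) x"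
  shows "F \<in> borel_measurable (\<mu> \<Otimes>\<^sub>M \<mu>)" "subgaussian (\<mu> \<Otimes>\<^sub>M \<mu>) F (1 / real n)"
    "\<And>z. z \<in> space (\<mu> \<Otimes>\<^sub>M \<mu>) \<Longrightarrow> \<bar>F z\<bar> \<le> 1"
proof -
  have haar: "haar_on n (stab n 0) \<mu>" using is_haar_imp_haar_on[OF \<mu>] by simp
  interpret unitary_haar n "stab n 0" \<mu> by (rule unitary_haar_stab[OF haar])
  interpret P: pair_prob_space \<mu> \<mu> ..
  have Mc: "M \<in> carrier_mat n n" and Nc: "N \<in> carrier_mat n n" using M N by (auto simp: hermitian_mat_def)
  have space_P: "space (\<mu> \<Otimes>\<^sub>M \<mu>) = unitary_set n \<times> unitary_set n"
    by (simp add: space_pair_measure)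
  have fst: "fst \<in> measurable (\<mu> \<Otimes>\<^sub>M \<mu>) (unitary_space n)" and snd: "snd \<in> measurable (\<mu> \<Otimes>\<^sub>M \<mu>) (unitary_space n)"
    by measurable
  have conj_entry: "(\<lambda>z. (g z * K * mat_adjoint (g z)) $$ (i, j)) \<in> borel_measurable (\<mu> \<Otimes>\<^sub>M \<mu>)"
    if g: "g \<in> measurable (\<mu> \<Otimes>\<^sub>M \<mu>) (unitary_space n)" and K: "K \<in> carrier_mat n n" and ij: "i < n" "j < n" for g K i j
  proof -
    have c: "g z \<in> carrier_mat n n" if "z \<in> space (\<mu> \<Otimes>\<^sub>M \<mu>)" for z
      using unitary_setD(1)[OF measurable_unitary_carrier[OF g that]] .
    show ?thesis
    proof (rule measurable_mult_entry[where n = n and m = n and p = n, OF _ _ _ _ ij])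
      show "(\<lambda>z. (g z * K) $$ (i, j)) \<in> borel_measurable (\<mu> \<Otimes>\<^sub>M \<mu>)" if "i < n" "j < n" for i j
        by (rule measurable_mult_entry[where n = n and m = n and p = n, OF _ _ _ _ that])
          (use c K measurable_unitary_entry[OF g] in auto)
      show "(\<lambda>z. mat_adjoint (g z) $$ (i, j)) \<in> borel_measurable (\<mu> \<Otimes>\<^sub>M \<mu>)" if "i < n" "j < n" for i j
        by (rule measurable_unitary_entry[OF measurable_unitary_adjoint[OF g] that])
    qed (use c K in \<open>auto intro: mult_carrier_mat\<close>)
  qed
  have herm: "hermitian_mat n (U * M * mat_adjoint U + V * N * mat_adjoint V)"
    if "U \<in> unitary_set n" "V \<in> unitary_set n" for U V
    by (rule rotated_sum_hermitian[OF M N]) (intro unitary_setD(1) that)+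
  have F: "F = (\<lambda>z. esd_cdf (fst z * M * mat_adjoint (fst z) + snd z * N * mat_adjoint (snd z)) x)"
    by (auto simp: F_def)
  show F_meas: "F \<in> borel_measurable (\<mu> \<Otimes>\<^sub>M \<mu>)"
    unfolding F
  proof (rule measurable_esd_cdf)
    fix i j assume ij: "i < n" "j < n"
    have "(\<lambda>z. (fst z * M * mat_adjoint (fst z) + snd z * N * mat_adjoint (snd z)) $$ (i, j)) \<in> borel_measurable (\<mu> \<Otimes>\<^sub>M \<mu>) \<longleftrightarrow>
      (\<lambda>z. (fst z * M * mat_adjoint (fst z)) $$ (i, j) + (snd z * N * mat_adjoint (snd z)) $$ (i, j)) \<in> borel_measurable (\<mu> \<Otimes>\<^sub>M \<mu>)"
    proof (rule measurable_cong)
      fix z assume "z \<in> space (\<mu> \<Otimes>\<^sub>M \<mu>)"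
      then have "snd z \<in> carrier_mat n n" using unitary_setD(1) unfolding space_P by auto
      then show "(fst z * M * mat_adjoint (fst z) + snd z * N * mat_adjoint (snd z)) $$ (i, j) =
          (fst z * M * mat_adjoint (fst z)) $$ (i, j) + (snd z * N * mat_adjoint (snd z)) $$ (i, j)"
        using ij by (intro index_add_mat) auto
    qed
    also have "\<dots>" by (intro borel_measurable_add conj_entry fst snd Mc Nc ij)
    finally show "(\<lambda>z. (fst z * M * mat_adjoint (fst z) + snd z * N * mat_adjoint (snd z)) $$ (i, j)) \<in> borel_measurable (\<mu> \<Otimes>\<^sub>M \<mu>)" .
  qed (use herm space_P in auto)
  note [measurable] = this
  have bound: "\<bar>F (U, V)\<bar> \<le> 1" if "U \<in> unitary_set n" "V \<in> unitary_set n" for U V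
    unfolding F_def split_conv by (rule esd_cdf_abs_le_one[OF herm[OF that]])
  then show FB: "\<bar>F z\<bar> \<le> 1" if "z \<in> space (\<mu> \<Otimes>\<^sub>M \<mu>)" for z
    using that unfolding space_P by auto
  \<comment> \<open>Each unitary passes through n steps of oscillation 2/n; the two resulting shares
    1/(2n) add up to 1/n.\<close>
  have const: "real (n - 0) * ((2 / real n)\<^sup>2 / 8) = 1 / (2 * real n)"
    using n by (simp add: power2_eq_square field_simps)
  have F_fst: "(\<lambda>V. F (U, V)) \<in> borel_measurable \<mu>" if "U \<in> unitary_set n" for U
    using that by (intro measurable_Pair2[OF F_meas]) simp
  have fibre: "subgaussian \<mu> (\<lambda>V. F (U, V)) (1 / (2 * real n))" if U: "U \<in> unitary_set n" for U
    unfolding const[symmetric]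
  proof (rule subgaussian_haar_stab[OF haar])
    show "(\<lambda>V. F (U, V)) \<in> borel_measurable (unitary_space n)"
      using F_fst[OF U] by (simp cong: measurable_cong_sets)
    fix V assume V: "V \<in> unitary_set n"
    show "\<bar>F (U, V)\<bar> \<le> 1" by (rule bound[OF U V])
    fix V' assume V': "V' \<in> unitary_set n" "nearby n V V'"
    show "\<bar>F (U, V) - F (U, V')\<bar> \<le> 2 / real n"
      unfolding F_def split_conv
      by (rule esd_cdf_nearby_right[OF M N n _ _ _ V'(2)]) (intro unitary_setD(1) U V V')+
  qed simp
  \<comment> \<open>The sensitivity of \<open>F\<close> in \<open>U\<close> is bounded uniformly in
    \<open>V\<close>, so it survives averaging over \<open>V\<close>, and the estimate for a single
    unitary applies to the mean.\<close>
  define m where "m U = (\<integral>V. F (U, V) \<partial>\<mu>)" for U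
  have mean: "subgaussian \<mu> m (1 / (2 * real n))"
    unfolding const[symmetric]
  proof (rule subgaussian_haar_stab[OF haar])
    have "m \<in> borel_measurable \<mu>" unfolding m_def by measurable
    then show "m \<in> borel_measurable (unitary_space n)" by (simp cong: measurable_cong_sets)
    have int: "integrable \<mu> (\<lambda>V. F (U, V))" if "U \<in> unitary_set n" for U
      by (rule integrable_const_bound[where B = 1, OF _ F_fst[OF that]]) (intro AE_I2, simp add: bound that)
    fix U assume U: "U \<in> unitary_set n"
    have "\<bar>m U\<bar> \<le> (\<integral>V. \<bar>F (U, V)\<bar> \<partial>\<mu>)" unfolding m_def by (rule integral_abs_bound)
    also have "\<dots> \<le> (\<integral>V. 1 \<partial>\<mu>)"
      using int[OF U] by (intro integral_mono) (auto simp: bound U)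
    finally show "\<bar>m U\<bar> \<le> 1" by simp
    fix U' assume U': "U' \<in> unitary_set n" "nearby n U U'"
    have "\<bar>m U - m U'\<bar> = \<bar>\<integral>V. F (U, V) - F (U', V) \<partial>\<mu>\<bar>"
      unfolding m_def using int[OF U] int[OF U'(1)] by simp
    also have "\<dots> \<le> (\<integral>V. \<bar>F (U, V) - F (U', V)\<bar> \<partial>\<mu>)" by (rule integral_abs_bound)
    also have "\<dots> \<le> (\<integral>V. 2 / real n \<partial>\<mu>)"
    proof (rule integral_mono)
      show "integrable \<mu> (\<lambda>V. \<bar>F (U, V) - F (U', V)\<bar>)" using int[OF U] int[OF U'(1)] by simp
      fix V assume "V \<in> space \<mu>"
      then have V: "V \<in> unitary_set n" by simp
      show "\<bar>F (U, V) - F (U', V)\<bar> \<le> 2 / real n"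
        unfolding F_def split_conv
        by (rule esd_cdf_nearby_left[OF M N n _ _ _ U'(2)]) (intro unitary_setD(1) U V U')+
    qed simp
    finally show "\<bar>m U - m U'\<bar> \<le> 2 / real n" by simp
  qed simp
  have "subgaussian (\<mu> \<Otimes>\<^sub>M \<mu>) F (1 / (2 * real n) + 1 / (2 * real n))"
  proof (rule subgaussian_fibres[OF _ _ F_meas FB])
    show "prob_space \<mu>" "prob_space \<mu>" by unfold_locales
    show "AE U in \<mu>. subgaussian \<mu> (\<lambda>V. F (U, V)) (1 / (2 * real n))"
      by (intro AE_I2 fibre) simp
    show "subgaussian \<mu> (\<lambda>U. \<integral>V. F (U, V) \<partial>\<mu>) (1 / (2 * real n))" using mean unfolding m_def .
  qed
  then show "subgaussian (\<mu> \<Otimes>\<^sub>M \<mu>) F (1 / real n)" by simp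
qed

theorem theorem1p1:
  "\<exists>\<kappa>::real. \<kappa> > 0 \<and>
    (\<forall>n::nat. \<forall>M N \<mu> x. n \<ge> 2 \<longrightarrow> hermitian_mat n M \<longrightarrow> hermitian_mat n N \<longrightarrow> is_haar n \<mu> \<longrightarrow>
      (let P = \<mu> \<Otimes>\<^sub>M \<mu>;
           F = (\<lambda>(U, V). esd_cdf (U * M * mat_adjoint U + V * N * mat_adjoint V) x)
       in prob_space.variance P F \<le> \<kappa> * ln (real n) / real n \<and>
          (\<forall>t::real. t \<ge> 0 \<longrightarrow>
             measure P {\<omega> \<in> space P. \<bar>F \<omega> - prob_space.expectation P F\<bar> \<ge> t}
               \<le> 2 * exp (- (real n * t\<^sup>2) / (2 * \<kappa> * ln (real n))))))"
proof (intro exI[of _ 8] conjI allI impI)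
  fix n :: nat and M N \<mu> x
  assume n: "n \<ge> 2" and hyps: "hermitian_mat n M" "hermitian_mat n N" "is_haar n \<mu>"
  let ?P = "\<mu> \<Otimes>\<^sub>M \<mu>"
  let ?F = "\<lambda>(U, V). esd_cdf (U * M * mat_adjoint U + V * N * mat_adjoint V) x"
  have "n > 0" using n by simp
  note F = subgaussian_esd_cdf_sum[OF this hyps, where x = x]
  have "prob_space \<mu>" using hyps(3) by (simp add: is_haar_def)
  then have P: "prob_space ?P"
    by (intro prob_space_pair)
  have v: "1 / real n > 0" using n by simp
  \<comment> \<open>Since e \<le> 3 \<le> 4, log n is at least 1/2 for n \<ge> 2. This turns the
    variance bound 4/n into 8 log n / n and fixes the constant 8.\<close>
  have "exp (1 / 2 :: real) \<le> 2"
  proof -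
    have "(exp (1 / 2 :: real))\<^sup>2 = exp 1" by (simp add: power2_eq_square exp_add[symmetric])
    also have "\<dots> \<le> 2\<^sup>2" using exp_le by simp
    finally show ?thesis by (rule power2_le_imp_le) simp
  qed
  then have "1 / 2 \<le> ln (2 :: real)" by (subst ln_ge_iff) auto
  also have "\<dots> \<le> ln (real n)" using n by simp
  finally have ln: "1 / 2 \<le> ln (real n)" .
  have "prob_space.variance ?P ?F \<le> 4 * (1 / real n)"
    by (rule subgaussian_variance[OF P F(1) F(3) F(2) v])
  also have "\<dots> \<le> 8 * ln (real n) / real n"
    using ln n by (simp add: divide_right_mono)
  finally have "prob_space.variance ?P ?F \<le> 8 * ln (real n) / real n" .
  moreover have "measure ?P {\<omega> \<in> space ?P. \<bar>?F \<omega> - prob_space.expectation ?P ?F\<bar> \<ge> t}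
      \<le> 2 * exp (- (real n * t\<^sup>2) / (2 * 8 * ln (real n)))" if t: "t \<ge> 0" for t
  proof -
    have "measure ?P {\<omega> \<in> space ?P. \<bar>?F \<omega> - prob_space.expectation ?P ?F\<bar> \<ge> t} \<le> 2 * exp (- t\<^sup>2 / (4 * (1 / real n)))"
      by (rule subgaussian_tail[OF P F(1) F(2) v t])
    \<comment> \<open>The denominator 16 log n is at least 8, hence larger than the 4 of the tail
      bound.\<close>
    also have "- t\<^sup>2 / (4 * (1 / real n)) \<le> - (real n * t\<^sup>2) / (2 * 8 * ln (real n))"
    proof -
      have "(real n * t\<^sup>2) / (2 * 8 * ln (real n)) \<le> (real n * t\<^sup>2) / 4"
        using ln by (intro divide_left_mono) auto
      then show ?thesis by (simp add: mult.commute)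
    qed
    finally show ?thesis by simp
  qed
  ultimately show "let P = ?P; F = ?F
       in prob_space.variance P F \<le> 8 * ln (real n) / real n \<and>
          (\<forall>t::real. t \<ge> 0 \<longrightarrow>
             measure P {\<omega> \<in> space P. \<bar>F \<omega> - prob_space.expectation P F\<bar> \<ge> t}
               \<le> 2 * exp (- (real n * t\<^sup>2) / (2 * 8 * ln (real n))))"
    unfolding Let_def by blast
qed simp

end
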